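(* Let $\Bbbk$ be an algebraically closed field of characteristic zero. Suppose $A \cong \Bbbk\langle x,y \mid f\rangle$ where $f \in \Bbbk\langle x,y\rangle$ is a polynomial of degree two. Then $A$ is isomorphic to one of the following algebras $\Bbbk\langle x,y \mid f\rangle$: \begin{itemize} \item $\mathcal{O}_q(\Bbbk^2)$, $f = xy-qyx$ ($q \in \Bbbk^\times$); \item $A_1^q(\Bbbk)$, $f = xy-qyx-1$ ($q \in \Bbbk^\times$); \item $\mathcal{J}$, $f = yx-xy+y^2$; \item $\mathcal{J}_1$, $f = yx-xy+y^2+1$; \item $\mathfrak{U}$, $f = yx-xy+y$; \item $\Bbbk[x]$, $f = x^2+y$; \item $R_{x^2}$, $f = x^2$; \item $R_{x^2-1}$, $f = x^2-1$; \item $R_{yx}$, $f = yx$; \item $\mathcal{S}$, $f = yx-1$. \end{itemize} Furthermore, the algebras $\mathcal{O}_q(\Bbbk^2)$ ($q\in\Bbbk^\times$), $A_1^q(\Bbbk)$ ($q\in\Bbbk^\times$), $\mathcal{J}$, $\mathcal{J}_1$, $\mathfrak{U}$, $\Bbbk[x]$, $R_{x^2}$, $R_{x^2-1}$, $R_{yx}$ and $\mathcal{S}$ are pairwise non-isomorphic, except that $\mathcal{O}_q(\Bbbk^2) \cong \mathcal{O}_{q^{-1}}(\Bbbk^2)$ and $A_1^q(\Bbbk) \cong A_1^{q^{-1}}(\Bbbk)$ for $q\in\Bbbk^\times$.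
   Context: $\Bbbk\langle x,y \mid f\rangle$ denotes the quotient of the free associative unital $\Bbbk$-algebra $\Bbbk\langle x,y\rangle$ by the two-sided ideal generated by $f$ (where $x,y$ have degree one). All algebras are $\Bbbk$-algebras and all isomorphisms are isomorphisms of $\Bbbk$-algebras. *)

theory Defs
  imports "HOL-Algebra.Algebraic_Closure_Type" "HOL-Library.Poly_Mapping"
begin

text \<open>
  The free monoid on two letters. It is written additively (and is not commutative), because
  the convolution product of \<^theory>\<open>HOL-Library.Poly_Mapping\<close> expects the exponents to
  form an additive monoid. With these exponents \<open>word \<Rightarrow>\<^sub>0 'k\<close> is the free associative
  unital algebra on two generators.
\<close>

datatype letter = Letter_x | Letter_y

datatype word = Word (letters: "letter list")

instantiation word :: monoid_add
begin

definition zero_word :: word where "0 = Word []"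

definition plus_word :: "word \<Rightarrow> word \<Rightarrow> word" where
  "u + v = Word (letters u @ letters v)"

instance
  by standard (simp_all add: zero_word_def plus_word_def)

end

type_synonym 'k ncpoly = "word \<Rightarrow>\<^sub>0 'k"

definition ncx :: "'k::field ncpoly" where
  "ncx = Poly_Mapping.single (Word [Letter_x]) 1"

definition ncy :: "'k::field ncpoly" where
  "ncy = Poly_Mapping.single (Word [Letter_y]) 1"

definition ncconst :: "'k::field \<Rightarrow> 'k ncpoly" where
  "ncconst c = Poly_Mapping.single 0 c"

text \<open>Total degree, both generators having degree one; the zero polynomial gets degree \<open>0\<close>.\<close>

definition ncdegree :: "'k::field ncpoly \<Rightarrow> nat" where
  "ncdegree f = Max (insert 0 ((\<lambda>w. length (letters w)) ` Poly_Mapping.keys f))"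

text \<open>
  The locale \<^locale>\<open>algebra\<close> of the library is restricted to commutative algebras.
\<close>

locale assoc_algebra = module K A + ring A for K (structure) and A (structure) +
  assumes smult_mult_left:
      "\<lbrakk>c \<in> carrier K; a \<in> carrier A; b \<in> carrier A\<rbrakk> \<Longrightarrow>
        (c \<odot>\<^bsub>A\<^esub> a) \<otimes>\<^bsub>A\<^esub> b = c \<odot>\<^bsub>A\<^esub> (a \<otimes>\<^bsub>A\<^esub> b)"
    and smult_mult_right:
      "\<lbrakk>c \<in> carrier K; a \<in> carrier A; b \<in> carrier A\<rbrakk> \<Longrightarrow>
        a \<otimes>\<^bsub>A\<^esub> (c \<odot>\<^bsub>A\<^esub> b) = c \<odot>\<^bsub>A\<^esub> (a \<otimes>\<^bsub>A\<^esub> b)"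

abbreviation is_algebra :: "('k::field, 'a) module \<Rightarrow> bool" where
  "is_algebra A \<equiv> assoc_algebra (ring_of_type_algebra :: 'k ring) A"

text \<open>The scalars \<open>'k\<close> form a whole type, so linearity is required for all of them.\<close>

definition alg_iso :: "('k, 'a) module \<Rightarrow> ('k, 'b) module \<Rightarrow> ('a \<Rightarrow> 'b) set" where
  "alg_iso A B =
    {h \<in> ring_iso A B. \<forall>c. \<forall>a \<in> carrier A. h (c \<odot>\<^bsub>A\<^esub> a) = c \<odot>\<^bsub>B\<^esub> h a}"

definition is_alg_iso :: "('k, 'a) module \<Rightarrow> ('k, 'b) module \<Rightarrow> bool" (infix \<open>\<cong>\<^sub>a\<^sub>l\<^sub>g\<close> 50) where
  "A \<cong>\<^sub>a\<^sub>l\<^sub>g B \<longleftrightarrow> alg_iso A B \<noteq> {}"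

definition free_algebra :: "('k::field, 'k ncpoly) module" where
  "free_algebra =
    ring.extend (ring_of_type_algebra :: 'k ncpoly ring)
      (module.fields (\<lambda>c. Poly_Mapping.map ((*) c)))"

text \<open>
  The ring \<open>R Quot I\<close> with the induced scalar multiplication, written in the style
  of \<^const>\<open>rcoset_mult\<close>.
\<close>

definition quot_algebra :: "('k, 'a) module \<Rightarrow> 'a set \<Rightarrow> ('k, 'a set) module" where
  "quot_algebra R I =
    ring.extend (R Quot I)
      (module.fields (\<lambda>c A. \<Union>a\<in>A. I +>\<^bsub>R\<^esub> (c \<odot>\<^bsub>R\<^esub> a)))"

text \<open>
  \<open>\<k>\<langle>x,y | f\<rangle>\<close>. Ideals in the sense of \<^locale>\<open>ideal\<close>, hence also \<^const>\<open>genideal\<close>, are two-sided.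
\<close>

definition presented :: "'k::field ncpoly \<Rightarrow> ('k, 'k ncpoly set) module" where
  "presented f = quot_algebra free_algebra (Idl\<^bsub>free_algebra\<^esub> {f})"

datatype 'k normal_form =
    QPlane 'k         \<comment> \<open>\<open>\<O>\<^sub>q(\<k>\<^sup>2)\<close>\<close>
  | QWeyl 'k          \<comment> \<open>\<open>A\<^sub>1\<^sup>q(\<k>)\<close>\<close>
  | Jordan            \<comment> \<open>\<open>\<J>\<close>\<close>
  | Jordan1           \<comment> \<open>\<open>\<J>\<^sub>1\<close>\<close>
  | Envel             \<comment> \<open>\<open>\<UU>\<close>\<close>
  | PolyX             \<comment> \<open>\<open>\<k>[x]\<close>\<close>
  | Rx2               \<comment> \<open>\<open>R\<close> with index \<open>x\<^sup>2\<close>\<close>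
  | Rx2m1             \<comment> \<open>\<open>R\<close> with index \<open>x\<^sup>2 - 1\<close>\<close>
  | Ryx               \<comment> \<open>\<open>R\<close> with index \<open>yx\<close>\<close>
  | Sone              \<comment> \<open>\<open>\<S>\<close>\<close>

fun relator :: "'k::field normal_form \<Rightarrow> 'k ncpoly" where
  "relator (QPlane q) = ncx * ncy - ncconst q * ncy * ncx"
| "relator (QWeyl q) = ncx * ncy - ncconst q * ncy * ncx - 1"
| "relator Jordan = ncy * ncx - ncx * ncy + ncy ^ 2"
| "relator Jordan1 = ncy * ncx - ncx * ncy + ncy ^ 2 + 1"
| "relator Envel = ncy * ncx - ncx * ncy + ncy"
| "relator PolyX = ncx ^ 2 + ncy"
| "relator Rx2 = ncx ^ 2"
| "relator Rx2m1 = ncx ^ 2 - 1"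
| "relator Ryx = ncy * ncx"
| "relator Sone = ncy * ncx - 1"

text \<open>The parameter of the first two families ranges over \<open>\<k>\<^sup>\<times>\<close>.\<close>

fun admissible :: "'k::field normal_form \<Rightarrow> bool" where
  "admissible (QPlane q) \<longleftrightarrow> q \<noteq> 0"
| "admissible (QWeyl q) \<longleftrightarrow> q \<noteq> 0"
| "admissible _ \<longleftrightarrow> True"

lemma free_algebra_simps [simp]:
  "carrier free_algebra = UNIV"
  "a \<otimes>\<^bsub>free_algebra\<^esub> b = a * b"
  "\<one>\<^bsub>free_algebra\<^esub> = 1"
  "\<zero>\<^bsub>free_algebra\<^esub> = 0"
  "a \<oplus>\<^bsub>free_algebra\<^esub> b = a + b"
  "c \<odot>\<^bsub>free_algebra\<^esub> a = Poly_Mapping.map ((*) c) a"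
  by (simp_all add: free_algebra_def ring.defs module.defs ring_of_type_algebra_def)

lemma ring_free_algebra: "ring (free_algebra :: ('k::field, _) module)"
  by (unfold_locales; (auto simp: Units_def algebra_simps)?)
     (metis add.right_inverse)+

text \<open>The scalar multiplication of the quotient is the one induced from representatives.\<close>

lemma presented_smult:
  fixes f :: "'k::field ncpoly"
  defines "I \<equiv> Idl\<^bsub>free_algebra\<^esub> {f}"
  shows "c \<odot>\<^bsub>presented f\<^esub> (I +>\<^bsub>free_algebra\<^esub> a) =
    I +>\<^bsub>free_algebra\<^esub> (Poly_Mapping.map ((*) c) a)"
proof -
  interpret R: ring "free_algebra :: ('k, 'k ncpoly) module" by (rule ring_free_algebra)
  interpret ideal I "free_algebra :: ('k, 'k ncpoly) module"
    unfolding I_def by (rule R.genideal_ideal) simp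
  have eq: "I +>\<^bsub>free_algebra\<^esub> (Poly_Mapping.map ((*) c) b) =
      I +>\<^bsub>free_algebra\<^esub> (Poly_Mapping.map ((*) c) a)"
    if b: "b \<in> I +>\<^bsub>free_algebra\<^esub> a" for b
  proof -
    obtain i where i: "i \<in> I" "b = i + a"
      using b by (auto simp: a_r_coset_def')
    have "Poly_Mapping.single 0 c * i \<in> I"
      using I_l_closed[OF i(1), of "Poly_Mapping.single 0 c"] by simp
    then have "Poly_Mapping.map ((*) c) b \<in> I +>\<^bsub>free_algebra\<^esub> (Poly_Mapping.map ((*) c) a)"
      by (auto simp: a_r_coset_def' i(2) mult_map_scale_conv_mult distrib_left)
    then show ?thesis
      by (simp add: a_repr_independence'[symmetric])
  qed
  have "a \<in> I +>\<^bsub>free_algebra\<^esub> a"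
    by (rule a_rcos_self) simp
  then have "(\<Union>b \<in> I +>\<^bsub>free_algebra\<^esub> a. I +>\<^bsub>free_algebra\<^esub> (Poly_Mapping.map ((*) c) b)) =
      I +>\<^bsub>free_algebra\<^esub> (Poly_Mapping.map ((*) c) a)"
    using eq by blast
  then show ?thesis
    by (simp add: presented_def quot_algebra_def I_def ring.defs module.defs)
qed

end

theory Submission
  imports Defs
begin

text \<open>
  \<^bold>\<open>Existence.\<close> The quadratic part of \<open>f\<close> is a bilinear form in two variables. Over an
  algebraically closed field it has an isotropic vector, so a linear change of variables removes the
  monomial \<open>x\<^sup>2\<close> (\<open>normal_form_quad\<close>). What is left is \<open>b xy + c yx + d y\<^sup>2\<close>, and a further shear
  turns it, up to a scalar and the swap of the variables, into one of \<open>xy - q yx\<close>, \<open>yx\<close>,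
  \<open>yx - xy + y\<^sup>2\<close>, \<open>x\<^sup>2\<close> (\<open>normal_form_isotropic\<close>). Translations and dilations then normalise the
  terms of lower degree. Affine substitutions do not suffice in one case: \<open>yx - xy + y\<^sup>2 + x\<close>
  says that the commutator of \<open>x\<close> and \<open>y\<close> is \<open>x + y\<^sup>2\<close>, so taking \<open>x + y\<^sup>2\<close> as a new generator
  gives the enveloping algebra \<open>\<UU>\<close> (\<open>iso_absorb_square\<close>).

  \<^bold>\<open>Non-isomorphism.\<close> All invariants come from homomorphisms into the scalars and into upper
  triangular two by two matrices. The homomorphisms \<open>\<k>\<langle>x,y | f\<rangle> \<rightarrow> \<k>\<close> are the points \<open>(a,b)\<close> of the
  plane curve \<open>f = 0\<close>. For two points \<open>p\<close>, \<open>p'\<close> the triangular representations with diagonal \<open>p\<close>,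
  \<open>p'\<close> are the \<open>(p,p')\<close>-derivations of the free algebra that kill \<open>f\<close>, the solutions \<open>(u,v)\<close> of a
  single linear equation \<open>\<alpha>u + \<beta>v = 0\<close>. The points are \<^emph>\<open>linked\<close> if \<open>\<alpha> = \<beta> = 0\<close>; for \<open>p \<noteq> p'\<close> this
  says that the one-dimensional modules \<open>p\<close> and \<open>p'\<close> have a nonsplit extension. The set of points, the
  functions on it given by elements of the algebra, and the relation of being linked are preserved by
  isomorphisms (\<open>pull_linked\<close>, \<open>invariants_mono\<close>), and they tell the ten families apart
  (\<open>recognise_relator\<close>).

  The same data recover the parameter. For \<open>q \<noteq> 1\<close> being linked is the graph of a self-map of the
  curve: on the quantum plane it multiplies one axis by \<open>q\<close> and the other by its inverse, on the
  quantum Weyl algebra it is a translation by \<open>q\<close> in the multiplicative group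
  \<open>(1 - q)ab = 1\<close>. An isomorphism induces a polynomial bijection of the curves with polynomial inverse.
  Such a map is affine on each axis of the cross \<open>ab = 0\<close>, respectively of the form \<open>t \<mapsto> c t\<^sup>n\<close> with
  \<open>n = \<plusminus>1\<close> on the multiplicative group, and intertwines the two self-maps only if the parameters agree
  up to inversion (\<open>qplane_parameter\<close>, \<open>qweyl_parameter\<close>).
\<close>

section \<open>Homomorphisms out of the free algebra\<close>

text \<open>
  A \<open>\<k>\<close>-algebra structure on a type-class ring, given as the map of the scalars into the centre. It
  lets one theory of homomorphisms serve the targets \<open>\<k>\<close>, \<open>\<k>[t]\<close>, \<open>\<k>\<langle>x,y\<rangle>\<close> and the triangular
  matrices.
\<close>

locale central_scalars =
  fixes \<iota> :: "'k::field \<Rightarrow> 'b::ring_1"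
  assumes scalar_add: "\<iota> (c + d) = \<iota> c + \<iota> d"
    and scalar_mult: "\<iota> (c * d) = \<iota> c * \<iota> d"
    and scalar_one: "\<iota> 1 = 1"
    and scalar_central: "\<iota> c * b = b * \<iota> c"
begin

lemma scalar_zero: "\<iota> 0 = 0"
  using scalar_add[of 0 0] by simp

end

text \<open>
  Unitality is the last clause at \<open>c = 1\<close>.
\<close>

definition nc_hom :: "('k::field \<Rightarrow> 'b::ring_1) \<Rightarrow> ('k ncpoly \<Rightarrow> 'b) \<Rightarrow> bool" where
  "nc_hom \<iota> h \<longleftrightarrow>
    (\<forall>a b. h (a + b) = h a + h b) \<and> (\<forall>a b. h (a * b) = h a * h b) \<and> (\<forall>c. h (ncconst c) = \<iota> c)"

lemma ncconst_simps:
  fixes c d :: "'k::field"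
  shows "ncconst (0 :: 'k) = 0" "ncconst (1 :: 'k) = 1"
    "ncconst (c + d) = ncconst c + ncconst d" "ncconst (c - d) = ncconst c - ncconst d"
    "ncconst (- c) = - ncconst c" "ncconst (c * d) = ncconst c * ncconst d"
  by (simp_all add: ncconst_def mult_single single_add single_uminus single_diff)

lemma ncconst_single: "ncconst c * Poly_Mapping.single w d = Poly_Mapping.single w (c * d)"
  by (simp add: ncconst_def mult_single)

lemma single_ncconst: "Poly_Mapping.single w d * ncconst c = Poly_Mapping.single w (d * c)"
  by (simp add: ncconst_def mult_single)

lemma single_Cons:
  "Poly_Mapping.single (Word (Letter_x # l)) (1::'k::field) = ncx * Poly_Mapping.single (Word l) 1"
  "Poly_Mapping.single (Word (Letter_y # l)) (1::'k::field) = ncy * Poly_Mapping.single (Word l) 1"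
  by (simp_all add: ncx_def ncy_def mult_single plus_word_def)

lemma poly_mapping_single_induct [case_names zero add]:
  assumes "P 0" "\<And>f w c. P f \<Longrightarrow> P (f + Poly_Mapping.single w c)"
  shows "P (f :: 'w \<Rightarrow>\<^sub>0 'c::monoid_add)"
proof (induction f rule: Poly_Mapping.update_induct)
  case const
  have "Poly_Mapping.single undefined 0 = (0 :: 'w \<Rightarrow>\<^sub>0 'c)" by simp
  then show ?case using assms(1) by simp
next
  case (update f a b)
  have "Poly_Mapping.update a b f = f + Poly_Mapping.single a b"
    using update(1)
    by (intro poly_mapping_eqI)
      (auto simp: lookup_update lookup_add lookup_single in_keys_iff when_def)
  then show ?case using assms(2) update by simp
qed

text \<open>
  An identity between two homomorphisms, or between two derivations, need only be tested on scalars
  and generators.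
\<close>

lemma ncpoly_induct [case_names const x y add mult]:
  fixes f :: "'k::field ncpoly"
  assumes "\<And>c. P (ncconst c)" "P ncx" "P ncy"
    and add: "\<And>a b. P a \<Longrightarrow> P b \<Longrightarrow> P (a + b)"
    and mult: "\<And>a b. P a \<Longrightarrow> P b \<Longrightarrow> P (a * b)"
  shows "P f"
proof (induction f rule: poly_mapping_single_induct)
  case zero
  show ?case using assms(1)[of 0] by (simp add: ncconst_simps)
next
  case (add f w c)
  have "P (Poly_Mapping.single (Word l) 1)" for l
  proof (induction l)
    case Nil
    show ?case using assms(1)[of 1] by (simp add: ncconst_def zero_word_def)
  next
    case (Cons z l)
    then show ?case using assms(2,3) mult by (cases z) (simp_all add: single_Cons)
  qed
  then have "P (Poly_Mapping.single w 1)" by (cases w) simp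
  then have "P (ncconst c * Poly_Mapping.single w 1)" using assms(1) mult by blast
  then show ?case using add assms(4) by (simp add: ncconst_single)
qed

fun word_value :: "'b::ring_1 \<Rightarrow> 'b \<Rightarrow> letter list \<Rightarrow> 'b" where
  "word_value s t [] = 1"
| "word_value s t (Letter_x # l) = s * word_value s t l"
| "word_value s t (Letter_y # l) = t * word_value s t l"

context
  fixes \<iota> :: "'k::field \<Rightarrow> 'b::ring_1" and h
  assumes h: "nc_hom \<iota> h"
begin

lemma nc_hom_add: "h (a + b) = h a + h b" using h by (simp add: nc_hom_def)
lemma nc_hom_mult: "h (a * b) = h a * h b" using h by (simp add: nc_hom_def)
lemma nc_hom_const: "h (ncconst c) = \<iota> c" using h by (simp add: nc_hom_def)
lemma nc_hom_zero: "h 0 = 0" using nc_hom_add[of 0 0] by simp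
lemma nc_hom_minus: "h (- a) = - h a"
  using nc_hom_add[of a "- a"] by (simp add: nc_hom_zero minus_unique)
lemma nc_hom_diff: "h (a - b) = h a - h b"
  using nc_hom_add[of a "- b"] by (simp add: nc_hom_minus)

lemma nc_hom_eqI:
  assumes "nc_hom \<iota> h'" "h ncx = h' ncx" "h ncy = h' ncy"
  shows "h a = h' a"
  using assms h by (induction a rule: ncpoly_induct) (simp_all add: nc_hom_def)

end

context central_scalars
begin

lemma nc_hom_one: "nc_hom \<iota> h \<Longrightarrow> h 1 = 1"
  using scalar_one by (metis nc_hom_const ncconst_simps(2))

lemma nc_hom_power: "nc_hom \<iota> h \<Longrightarrow> h (a ^ n) = h a ^ n"
  by (induction n) (simp_all add: nc_hom_one nc_hom_mult)

lemmas hom_simps = nc_hom_add nc_hom_mult nc_hom_const nc_hom_zero nc_hom_minus nc_hom_diff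
  nc_hom_one nc_hom_power

text \<open>
  The universal property of the free algebra: \<open>eval s t\<close> is the homomorphism with
  \<open>x \<mapsto> s\<close> and \<open>y \<mapsto> t\<close>.
\<close>

definition eval :: "'b \<Rightarrow> 'b \<Rightarrow> 'k ncpoly \<Rightarrow> 'b" where
  "eval s t f =
    (\<Sum>w\<in>Poly_Mapping.keys f. \<iota> (Poly_Mapping.lookup f w) * word_value s t (letters w))"

lemma word_value_append: "word_value s t (l @ l') = word_value s t l * word_value s t l'"
  by (induction s t l rule: word_value.induct) (simp_all add: mult.assoc)

lemma eval_superset:
  assumes "finite S" "Poly_Mapping.keys f \<subseteq> S"
  shows "eval s t f = (\<Sum>w\<in>S. \<iota> (Poly_Mapping.lookup f w) * word_value s t (letters w))"
  unfolding eval_def using assms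
  by (intro sum.mono_neutral_left) (auto simp: in_keys_iff scalar_zero)

lemma eval_add: "eval s t (f + g) = eval s t f + eval s t g"
proof -
  let ?S = "Poly_Mapping.keys f \<union> Poly_Mapping.keys g"
  have "eval s t (f + g) =
      (\<Sum>w\<in>?S. \<iota> (Poly_Mapping.lookup (f + g) w) * word_value s t (letters w))"
    using Poly_Mapping.keys_add[of f g] by (intro eval_superset) auto
  then show ?thesis
    by (simp add: eval_superset[of ?S f] eval_superset[of ?S g] lookup_add scalar_add
        distrib_right sum.distrib)
qed

lemma eval_single: "eval s t (Poly_Mapping.single w c) = \<iota> c * word_value s t (letters w)"
  by (cases "c = 0") (simp_all add: eval_def scalar_zero)

lemma eval_zero: "eval s t 0 = 0" by (simp add: eval_def)

lemma eval_mult_single: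
  "eval s t (f * Poly_Mapping.single w c) = eval s t f * eval s t (Poly_Mapping.single w c)"
proof (induction f rule: poly_mapping_single_induct)
  case (add f v d)
  let ?V = "word_value s t (letters v)" and ?W = "word_value s t (letters w)"
  have "\<iota> (d * c) * (?V * ?W) = \<iota> d * ?V * (\<iota> c * ?W)"
    by (simp add: scalar_mult mult.assoc) (metis scalar_central mult.assoc)
  then have "eval s t (Poly_Mapping.single v d * Poly_Mapping.single w c) =
      eval s t (Poly_Mapping.single v d) * eval s t (Poly_Mapping.single w c)"
    by (simp add: mult_single eval_single plus_word_def word_value_append)
  then show ?case using add by (simp add: distrib_right eval_add)
qed (simp add: eval_zero)

lemma eval_mult: "eval s t (f * g) = eval s t f * eval s t g"
  by (induction g rule: poly_mapping_single_induct)
    (simp_all add: eval_zero distrib_left eval_add eval_mult_single)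

theorem eval_hom: "nc_hom \<iota> (eval s t)"
  by (simp add: nc_hom_def eval_add eval_mult ncconst_def eval_single zero_word_def)

lemma eval_x [simp]: "eval s t ncx = s" and eval_y [simp]: "eval s t ncy = t"
  by (simp_all add: ncx_def ncy_def eval_single scalar_one)

lemma hom_is_eval: "nc_hom \<iota> h \<Longrightarrow> h a = eval (h ncx) (h ncy) a"
  by (rule nc_hom_eqI[OF _ eval_hom]) simp_all

lemmas eval_simps = hom_simps[OF eval_hom]

end

lemma ncconst_commute: "ncconst c * a = a * ncconst c"
  by (induction a rule: poly_mapping_single_induct)
    (simp_all add: algebra_simps ncconst_single single_ncconst)

text \<open>
  The same homomorphism \<open>eval\<close> is a substitution when the target is the free algebra, a point
  of the plane when the target is the field, and the restriction to a parametrised curve when it is a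
  polynomial ring.
\<close>

interpretation subst: central_scalars "ncconst :: 'k::field \<Rightarrow> _"
  by standard (simp_all add: ncconst_simps, rule ncconst_commute)

interpretation point: central_scalars "\<lambda>c::'k::field. c"
  by standard simp_all

interpretation curve: central_scalars "\<lambda>c::'k::field. [:c:]"
  by standard (simp_all add: one_pCons)

text \<open>
  Upper triangular two by two matrices, as \<open>(1,1)\<close>, \<open>(1,2)\<close> and \<open>(2,2)\<close> entries. The diagonal
  entries of a homomorphism into them are points, and the corner entry is a skew derivation
  between these.
\<close>

datatype 'k tri = Tri (ul: 'k) (ur: 'k) (lr: 'k)

instantiation tri :: (field) ring_1
begin

definition "0 = Tri 0 0 0"
definition "1 = Tri 1 0 1"
definition "A + B = Tri (ul A + ul B) (ur A + ur B) (lr A + lr B)"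
definition "- A = Tri (- ul A) (- ur A) (- lr A)"
definition "A - B = Tri (ul A - ul B) (ur A - ur B) (lr A - lr B)"
definition "A * B = Tri (ul A * ul B) (ul A * ur B + ur A * lr B) (lr A * lr B)"

instance
proof
  fix A B C :: "'a tri"
  note defs = zero_tri_def one_tri_def plus_tri_def uminus_tri_def minus_tri_def times_tri_def
  show "A * B * C = A * (B * C)" by (rule tri.expand) (simp add: defs algebra_simps)
  show "(A + B) * C = A * C + B * C" by (rule tri.expand) (simp add: defs algebra_simps)
  show "A * (B + C) = A * B + A * C" by (rule tri.expand) (simp add: defs algebra_simps)
  show "A + B + C = A + (B + C)" by (rule tri.expand) (simp add: defs)
  show "A + B = B + A" by (rule tri.expand) (simp add: defs)
  show "1 * A = A" "A * 1 = A" "0 + A = A" "- A + A = 0" "A - B = A + - B" "(0 :: 'a tri) \<noteq> 1"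
    by (rule tri.expand, simp add: defs)+ (simp add: defs)
qed

end

lemma tri_simps [simp]:
  "Tri a b c + Tri a' b' c' = Tri (a + a') (b + b') (c + c')"
  "Tri a b c * Tri a' b' c' = Tri (a * a') (a * b' + b * c') (c * c')"
  "ul (A + B) = ul A + ul B" "ur (A + B) = ur A + ur B" "lr (A + B) = lr A + lr B"
  "ul (A * B) = ul A * ul B" "ur (A * B) = ul A * ur B + ur A * lr B" "lr (A * B) = lr A * lr B"
  by (simp_all add: plus_tri_def times_tri_def)

definition tri_scalar :: "'k::field \<Rightarrow> 'k tri" where
  "tri_scalar c = Tri c 0 c"

interpretation triangular: central_scalars "tri_scalar :: 'k::field \<Rightarrow> _"
proof
  fix c d :: 'k and A :: "'k tri"
  show "tri_scalar c * A = A * tri_scalar c"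
    by (cases A) (simp add: tri_scalar_def mult.commute)
  show "tri_scalar (c + d) = tri_scalar c + tri_scalar d"
    "tri_scalar (c * d) = tri_scalar c * tri_scalar d" by (simp_all add: tri_scalar_def)
  show "tri_scalar (1 :: 'k) = 1" by (simp only: one_tri_def tri_scalar_def)
qed

section \<open>Isomorphisms of presented algebras\<close>

abbreviation rel_ideal :: "'k::field ncpoly \<Rightarrow> 'k ncpoly set" where
  "rel_ideal f \<equiv> Idl\<^bsub>free_algebra\<^esub> {f}"

abbreviation residue :: "'k::field ncpoly \<Rightarrow> 'k ncpoly \<Rightarrow> 'k ncpoly set" where
  "residue f a \<equiv> rel_ideal f +>\<^bsub>free_algebra\<^esub> a"

context
  fixes f :: "'k::field ncpoly"
begin

lemma ideal_rel_ideal: "ideal (rel_ideal f) free_algebra"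
  by (rule ring.genideal_ideal[OF ring_free_algebra]) simp

lemma rel_ideal_self: "f \<in> rel_ideal f"
  by (rule ring.genideal_self'[OF ring_free_algebra]) simp

lemma rel_ideal_mult:
  assumes "a \<in> rel_ideal f"
  shows "b * a \<in> rel_ideal f" "a * b \<in> rel_ideal f"
  using ideal.I_l_closed[OF ideal_rel_ideal assms, of b]
    ideal.I_r_closed[OF ideal_rel_ideal assms, of b] by simp_all

lemma rel_ideal_add: "a \<in> rel_ideal f \<Longrightarrow> b \<in> rel_ideal f \<Longrightarrow> a + b \<in> rel_ideal f"
  using additive_subgroup.a_closed[OF ideal.axioms(1)[OF ideal_rel_ideal], of a b] by simp

lemma rel_ideal_zero: "0 \<in> rel_ideal f"
  using rel_ideal_mult(1)[OF rel_ideal_self, of 0] by simp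

lemma rel_ideal_minus: "a \<in> rel_ideal f \<Longrightarrow> - a \<in> rel_ideal f"
  using rel_ideal_mult(1)[of a "- 1"] by simp

lemma rel_ideal_diff: "a \<in> rel_ideal f \<Longrightarrow> b \<in> rel_ideal f \<Longrightarrow> a - b \<in> rel_ideal f"
  using rel_ideal_add[of a "- b"] rel_ideal_minus by simp

lemma rel_ideal_minimal:
  assumes "f \<in> I" and add: "\<And>a b. a \<in> I \<Longrightarrow> b \<in> I \<Longrightarrow> a + b \<in> I"
    and mult: "\<And>a b. a \<in> I \<Longrightarrow> b * a \<in> I" "\<And>a b. a \<in> I \<Longrightarrow> a * b \<in> I"
  shows "rel_ideal f \<subseteq> I"
proof (rule ring.genideal_minimal[OF ring_free_algebra])
  interpret R: ring "free_algebra :: ('k, _) module" by (rule ring_free_algebra)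
  have neg: "\<ominus>\<^bsub>free_algebra\<^esub> a = - a" for a :: "'k ncpoly"
    by (rule R.minus_equality) simp_all
  show "ideal I free_algebra"
  proof (intro idealI ring_free_algebra R.add.subgroupI)
    show "I \<noteq> {}" using assms(1) by blast
    show "\<ominus>\<^bsub>free_algebra\<^esub> a \<in> I" if "a \<in> I" for a
      using mult(1)[OF that, of "- 1"] by (simp add: neg)
  qed (use assms in auto)
qed (use assms in simp)

lemma residue_eq_iff: "residue f a = residue f b \<longleftrightarrow> a - b \<in> rel_ideal f"
proof -
  interpret R: ring "free_algebra :: ('k, _) module" by (rule ring_free_algebra)
  interpret ideal "rel_ideal f" free_algebra by (rule ideal_rel_ideal)
  have "a \<in> residue f b \<longleftrightarrow> a - b \<in> rel_ideal f"
    by (auto simp: a_r_coset_def') (metis diff_add_cancel)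
  moreover have "a \<in> residue f a" by (rule a_rcos_self) simp
  moreover have "residue f a = residue f b" if "a \<in> residue f b"
    using that by (simp add: a_repr_independence'[symmetric])
  ultimately show ?thesis by auto
qed

lemma presented_simps:
  "carrier (presented f) = range (residue f)"
  "residue f a \<otimes>\<^bsub>presented f\<^esub> residue f b = residue f (a * b)"
  "residue f a \<oplus>\<^bsub>presented f\<^esub> residue f b = residue f (a + b)"
  "\<one>\<^bsub>presented f\<^esub> = residue f 1"
  "c \<odot>\<^bsub>presented f\<^esub> residue f a = residue f (ncconst c * a)"
proof -
  interpret R: ring "free_algebra :: ('k, _) module" by (rule ring_free_algebra)
  interpret ideal "rel_ideal f" free_algebra by (rule ideal_rel_ideal)
  show "carrier (presented f) = range (residue f)"
    by (auto simp: presented_def quot_algebra_def ring.defs module.defs FactRing_def A_RCOSETS_def')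
  show "residue f a \<otimes>\<^bsub>presented f\<^esub> residue f b = residue f (a * b)"
    using rcoset_mult_add[of a b]
    by (simp add: presented_def quot_algebra_def ring.defs module.defs FactRing_def)
  show "residue f a \<oplus>\<^bsub>presented f\<^esub> residue f b = residue f (a + b)"
    using a_rcos_sum[of a b]
    by (simp add: presented_def quot_algebra_def ring.defs module.defs FactRing_def)
  show "\<one>\<^bsub>presented f\<^esub> = residue f 1"
    by (simp add: presented_def quot_algebra_def ring.defs module.defs FactRing_def)
  show "c \<odot>\<^bsub>presented f\<^esub> residue f a = residue f (ncconst c * a)"
    by (simp add: presented_smult mult_map_scale_conv_mult ncconst_def)
qed

end

text \<open>
  An isomorphism of the quotients, lifted to the free algebra. The lifts are inverse to each other
  only modulo the two ideals; working with them keeps cosets out of all later arguments.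
\<close>

definition inverse_substitutions ::
    "'k::field ncpoly \<Rightarrow> 'k ncpoly \<Rightarrow> ('k ncpoly \<Rightarrow> 'k ncpoly) \<Rightarrow> ('k ncpoly \<Rightarrow> 'k ncpoly) \<Rightarrow> bool"
  where
  "inverse_substitutions f g \<phi> \<psi> \<longleftrightarrow>
    nc_hom ncconst \<phi> \<and> nc_hom ncconst \<psi> \<and> \<phi> f \<in> rel_ideal g \<and> \<psi> g \<in> rel_ideal f \<and>
    (\<forall>a. \<psi> (\<phi> a) - a \<in> rel_ideal f) \<and> (\<forall>a. \<phi> (\<psi> a) - a \<in> rel_ideal g)"

lemma inverse_substitutions_sym:
  "inverse_substitutions f g \<phi> \<psi> \<Longrightarrow> inverse_substitutions g f \<psi> \<phi>"
  by (simp add: inverse_substitutions_def)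

lemma nc_hom_rel_ideal:
  assumes "nc_hom ncconst \<phi>" "\<phi> f \<in> rel_ideal g" "a \<in> rel_ideal f"
  shows "\<phi> a \<in> rel_ideal g"
proof -
  have "rel_ideal f \<subseteq> {a. \<phi> a \<in> rel_ideal g}"
    using assms(1,2)
    by (intro rel_ideal_minimal) (simp_all add: subst.hom_simps rel_ideal_add rel_ideal_mult)
  then show ?thesis using assms(3) by blast
qed

text \<open>
  Choosing representatives of the images of the generators lifts an isomorphism and its inverse to
  substitutions, since the free algebra is free; conversely substitutions compatible with the ideals
  descend.
\<close>

lemma presented_iso_iff:
  "presented f \<cong>\<^sub>a\<^sub>l\<^sub>g presented g \<longleftrightarrow> (\<exists>\<phi> \<psi>. inverse_substitutions f g \<phi> \<psi>)"
proof
  assume "presented f \<cong>\<^sub>a\<^sub>l\<^sub>g presented g"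
  then obtain h where h: "h \<in> ring_hom (presented f) (presented g)"
    and bij: "bij_betw h (range (residue f)) (range (residue g))"
    and smult: "\<And>c a. h (residue f (ncconst c * a)) = c \<odot>\<^bsub>presented g\<^esub> h (residue f a)"
    by (fastforce simp: is_alg_iso_def alg_iso_def ring_iso_def presented_simps)
  have inj: "a - b \<in> rel_ideal f" if "h (residue f a) = h (residue f b)" for a b
    using bij that by (auto simp: bij_betw_def inj_on_def residue_eq_iff)
  have surj: "\<exists>a. h (residue f a) = residue g b" for b
    using bij unfolding bij_betw_def by (metis (no_types, lifting) imageE rangeI)
  have into: "\<exists>b. h (residue f a) = residue g b" for a
    using bij unfolding bij_betw_def by blast
  have add: "h (residue f (a + b)) = h (residue f a) \<oplus>\<^bsub>presented g\<^esub> h (residue f b)"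
    and mult: "h (residue f (a * b)) = h (residue f a) \<otimes>\<^bsub>presented g\<^esub> h (residue f b)" for a b
    using ring_hom_add[OF h, of "residue f a" "residue f b"]
      ring_hom_mult[OF h, of "residue f a" "residue f b"]
    by (simp_all add: presented_simps)
  have const: "h (residue f (ncconst c)) = residue g (ncconst c)" for c
    using smult[of c 1] ring_hom_one[OF h] by (simp add: presented_simps)
  obtain u v where u: "h (residue f ncx) = residue g u" and v: "h (residue f ncy) = residue g v"
    using into by meson
  obtain u' v' where u': "h (residue f u') = residue g ncx" and v': "h (residue f v') = residue g ncy"
    using surj by meson
  define \<phi> \<psi> where "\<phi> = subst.eval u v" and "\<psi> = subst.eval u' v'"
  have hom: "nc_hom ncconst \<phi>" "nc_hom ncconst \<psi>"
    by (simp_all add: \<phi>_def \<psi>_def subst.eval_hom)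
  have \<phi>: "h (residue f a) = residue g (\<phi> a)" for a
    by (induction a rule: ncpoly_induct)
      (simp_all add: const add mult u v \<phi>_def subst.eval_simps presented_simps)
  have \<psi>: "h (residue f (\<psi> a)) = residue g a" for a
    by (induction a rule: ncpoly_induct)
      (simp_all add: const add mult u' v' \<psi>_def subst.eval_simps presented_simps)
  have "\<psi> (\<phi> a) - a \<in> rel_ideal f" for a
    by (rule inj) (simp add: \<psi>, simp add: \<phi>)
  moreover have "\<phi> (\<psi> a) - a \<in> rel_ideal g" for a
    using \<phi>[of "\<psi> a"] \<psi>[of a] by (simp add: residue_eq_iff[symmetric])
  moreover have "\<phi> f \<in> rel_ideal g"
  proof -
    have "residue f f = residue f 0" by (simp add: residue_eq_iff rel_ideal_self)
    then have "residue g (\<phi> f) = residue g (\<phi> 0)" by (metis \<phi>)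
    then show ?thesis by (simp add: residue_eq_iff subst.hom_simps[OF hom(1)])
  qed
  moreover have "\<psi> g \<in> rel_ideal f"
  proof -
    have "residue g g = residue g 0" by (simp add: residue_eq_iff rel_ideal_self)
    then have "h (residue f (\<psi> g)) = h (residue f (\<psi> 0))" by (simp only: \<psi>)
    then show ?thesis using inj[of "\<psi> g" "\<psi> 0"] by (simp add: subst.hom_simps[OF hom(2)])
  qed
  ultimately show "\<exists>\<phi> \<psi>. inverse_substitutions f g \<phi> \<psi>"
    using hom unfolding inverse_substitutions_def by blast
next
  assume "\<exists>\<phi> \<psi>. inverse_substitutions f g \<phi> \<psi>"
  then obtain \<phi> \<psi> where hom: "nc_hom ncconst \<phi>" "nc_hom ncconst \<psi>"
    and rel: "\<phi> f \<in> rel_ideal g" "\<psi> g \<in> rel_ideal f"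
    and inv: "\<And>a. \<psi> (\<phi> a) - a \<in> rel_ideal f" "\<And>a. \<phi> (\<psi> a) - a \<in> rel_ideal g"
    by (auto simp: inverse_substitutions_def)
  note \<phi>_simps = subst.hom_simps[OF hom(1)]
  define h where "h C = residue g (\<phi> (SOME a. residue f a = C))" for C
  have h: "h (residue f a) = residue g (\<phi> a)" for a
  proof -
    have "residue f (SOME b. residue f b = residue f a) = residue f a"
      by (rule someI) simp
    then show ?thesis
      unfolding h_def residue_eq_iff nc_hom_diff[OF hom(1), symmetric]
      by (rule nc_hom_rel_ideal[OF hom(1) rel(1)])
  qed
  have "inj_on h (range (residue f))"
  proof (rule inj_onI, elim rangeE, simp add: h)
    fix a b assume "residue g (\<phi> a) = residue g (\<phi> b)"
    then have "\<psi> (\<phi> (a - b)) \<in> rel_ideal f"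
      by (simp add: residue_eq_iff nc_hom_diff[OF hom(1), symmetric] nc_hom_rel_ideal[OF hom(2) rel(2)])
    from rel_ideal_diff[OF this inv(1)[of "a - b"]] show "residue f a = residue f b"
      by (simp add: residue_eq_iff)
  qed
  moreover have "residue g b \<in> h ` range (residue f)" for b
  proof -
    have "h (residue f (\<psi> b)) = residue g b" by (simp add: h residue_eq_iff inv)
    then show ?thesis by (metis rangeI image_eqI)
  qed
  ultimately have "bij_betw h (carrier (presented f)) (carrier (presented g))"
    by (auto simp: bij_betw_def presented_simps h)
  then have "h \<in> alg_iso (presented f) (presented g)"
    by (auto simp: alg_iso_def ring_iso_def ring_hom_def presented_simps h \<phi>_simps)
  then show "presented f \<cong>\<^sub>a\<^sub>l\<^sub>g presented g" by (auto simp: is_alg_iso_def)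
qed

lemma alg_iso_trans: "A \<cong>\<^sub>a\<^sub>l\<^sub>g B \<Longrightarrow> B \<cong>\<^sub>a\<^sub>l\<^sub>g C \<Longrightarrow> A \<cong>\<^sub>a\<^sub>l\<^sub>g C"
proof -
  assume "A \<cong>\<^sub>a\<^sub>l\<^sub>g B" "B \<cong>\<^sub>a\<^sub>l\<^sub>g C"
  then obtain h k where h: "h \<in> alg_iso A B" and k: "k \<in> alg_iso B C"
    by (auto simp: is_alg_iso_def)
  have "k \<circ> h \<in> ring_iso A C"
    using h k ring_iso_set_trans by (auto simp: alg_iso_def)
  moreover have "h a \<in> carrier B" if "a \<in> carrier A" for a
    using h that by (auto simp: alg_iso_def ring_iso_def ring_hom_def)
  ultimately have "k \<circ> h \<in> alg_iso A C"
    using h k by (auto simp: alg_iso_def)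
  then show "A \<cong>\<^sub>a\<^sub>l\<^sub>g C" by (auto simp: is_alg_iso_def)
qed

lemma presented_iso_refl: "presented f \<cong>\<^sub>a\<^sub>l\<^sub>g presented f"
  by (auto simp: is_alg_iso_def alg_iso_def intro: ring_iso_set_refl)

lemma presented_iso_sym: "presented f \<cong>\<^sub>a\<^sub>l\<^sub>g presented g \<Longrightarrow> presented g \<cong>\<^sub>a\<^sub>l\<^sub>g presented f"
  unfolding presented_iso_iff by (blast intro: inverse_substitutions_sym)

text \<open>
  Every step of the classification is a change of variables that is invertible on the free algebra
  itself, followed by a rescaling of the relator.
\<close>

lemma iso_by_substitution:
  assumes inv: "subst.eval u' v' u = ncx" "subst.eval u' v' v = ncy"
      "subst.eval u v u' = ncx" "subst.eval u v v' = ncy"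
    and "subst.eval u v f = ncconst c * g" "c \<noteq> 0"
  shows "presented f \<cong>\<^sub>a\<^sub>l\<^sub>g presented g"
proof -
  define \<phi> \<psi> where "\<phi> = subst.eval u v" and "\<psi> = subst.eval u' v'"
  have hom: "nc_hom ncconst \<phi>" "nc_hom ncconst \<psi>"
    by (simp_all add: \<phi>_def \<psi>_def subst.eval_hom)
  note simps = subst.hom_simps[OF hom(1)] subst.hom_simps[OF hom(2)]
  have \<psi>\<phi>: "\<psi> (\<phi> a) = a" for a
    by (induction a rule: ncpoly_induct)
      (simp_all add: simps, simp_all add: \<phi>_def \<psi>_def inv)
  have \<phi>\<psi>: "\<phi> (\<psi> a) = a" for a
    by (induction a rule: ncpoly_induct)
      (simp_all add: simps, simp_all add: \<phi>_def \<psi>_def inv)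
  have f: "\<phi> f = ncconst c * g" using assms(5) by (simp add: \<phi>_def)
  have "ncconst (inverse c) * \<phi> f = g"
    using \<open>c \<noteq> 0\<close> by (simp add: f mult.assoc[symmetric] ncconst_simps(2) flip: ncconst_simps(6))
  then have "\<psi> g = ncconst (inverse c) * f"
    by (metis nc_hom_mult[OF hom(2)] nc_hom_const[OF hom(2)] \<psi>\<phi>)
  then have "inverse_substitutions f g \<phi> \<psi>"
    using hom by (simp add: inverse_substitutions_def \<psi>\<phi> \<phi>\<psi> f rel_ideal_zero
        rel_ideal_mult rel_ideal_self)
  then show ?thesis using presented_iso_iff by blast
qed

section \<open>Reduction of quadratic relators to normal form\<close>

definition quad :: "'k::field \<Rightarrow> 'k \<Rightarrow> 'k \<Rightarrow> 'k \<Rightarrow> 'k \<Rightarrow> 'k \<Rightarrow> 'k \<Rightarrow> 'k ncpoly" where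
  "quad A B C D E F G =
    ncconst A * (ncx * ncx) + ncconst B * (ncx * ncy) + ncconst C * (ncy * ncx) +
    ncconst D * (ncy * ncy) + ncconst E * ncx + ncconst F * ncy + ncconst G"

text \<open>
  Moving the scalars to the left of the variables, in a fixed order, lets the simplifier compare two
  noncommutative polynomials with symbolic coefficients.
\<close>

lemma scalars_left:
  "ncx * ncconst c = ncconst c * ncx" "ncy * ncconst c = ncconst c * ncy"
  "ncx * (ncconst c * a) = ncconst c * (ncx * a)" "ncy * (ncconst c * a) = ncconst c * (ncy * a)"
  "ncconst c * ncconst d = ncconst d * ncconst c"
  "ncconst c * (ncconst d * a) = ncconst d * (ncconst c * a)"
  by (metis ncconst_commute mult.assoc)+

lemma ncconst_two: "ncconst 2 * a = a + a"
  by (metis ncconst_simps(2,3) mult_2 one_add_one)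

lemmas nc_expand = ncconst_two distrib_left distrib_right left_diff_distrib right_diff_distrib mult.assoc
  ncconst_simps scalars_left

lemma quad_affine_subst:
  "subst.eval (ncconst \<alpha> * ncx + ncconst \<beta> * ncy + ncconst \<gamma>) ncy (quad A B C D E F G) =
    quad (\<alpha> * \<alpha> * A) (\<alpha> * (\<beta> * A + B)) (\<alpha> * (\<beta> * A + C)) (\<beta> * \<beta> * A + \<beta> * (B + C) + D)
      (\<alpha> * (\<gamma> * A + \<gamma> * A + E)) (\<beta> * \<gamma> * A + \<beta> * \<gamma> * A + \<gamma> * (B + C) + \<beta> * E + F)
      (\<gamma> * \<gamma> * A + \<gamma> * E + G)"
  by (simp add: quad_def subst.eval_simps nc_expand add_ac)

text \<open>
  Together with the swap of the variables, the substitutions \<open>x \<mapsto> \<alpha>x + \<beta>y + \<gamma>\<close> generate the affine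
  group of the plane.
\<close>

lemma iso_affine:
  assumes "\<alpha> \<noteq> 0"
  shows "presented (quad A B C D E F G) \<cong>\<^sub>a\<^sub>l\<^sub>g presented
    (quad (\<alpha> * \<alpha> * A) (\<alpha> * (\<beta> * A + B)) (\<alpha> * (\<beta> * A + C)) (\<beta> * \<beta> * A + \<beta> * (B + C) + D)
      (\<alpha> * (\<gamma> * A + \<gamma> * A + E)) (\<beta> * \<gamma> * A + \<beta> * \<gamma> * A + \<gamma> * (B + C) + \<beta> * E + F)
      (\<gamma> * \<gamma> * A + \<gamma> * E + G))" (is "_ \<cong>\<^sub>a\<^sub>l\<^sub>g presented ?g")
proof (rule iso_by_substitution)
  let ?u = "ncconst \<alpha> * ncx + ncconst \<beta> * ncy + ncconst \<gamma>"
  let ?u' = "ncconst (inverse \<alpha>) * (ncx - ncconst \<beta> * ncy - ncconst \<gamma>)"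
  have inv: "ncconst \<alpha> * (ncconst (inverse \<alpha>) * a) = a"
    "ncconst (inverse \<alpha>) * (ncconst \<alpha> * a) = a" for a
    using assms by (simp_all add: mult.assoc[symmetric] ncconst_simps(2) flip: ncconst_simps(6))
  show "subst.eval ?u' ncy ?u = ncx"
    by (simp add: subst.eval_simps inv)
  show "subst.eval ?u ncy ?u' = ncx"
    by (simp add: subst.eval_simps inv)
  show "subst.eval ?u ncy (quad A B C D E F G) = ncconst 1 * ?g"
    by (simp add: quad_affine_subst ncconst_simps)
qed (simp_all add: subst.eval_simps)

lemma iso_swap: "presented (quad A B C D E F G) \<cong>\<^sub>a\<^sub>l\<^sub>g presented (quad D C B A F E G)"
proof (rule iso_by_substitution[where u' = ncy and v' = ncx])
  show "subst.eval ncy ncx (quad A B C D E F G) = ncconst 1 * quad D C B A F E G"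
    by (simp add: quad_def subst.eval_simps ncconst_simps add_ac)
qed (simp_all add: subst.eval_simps)

lemma iso_scale:
  assumes "c \<noteq> 0"
  shows "presented (quad A B C D E F G) \<cong>\<^sub>a\<^sub>l\<^sub>g
    presented (quad (c * A) (c * B) (c * C) (c * D) (c * E) (c * F) (c * G))"
proof (rule presented_iso_sym, rule iso_by_substitution[where u' = ncx and v' = ncy])
  show "subst.eval ncx ncy (quad (c * A) (c * B) (c * C) (c * D) (c * E) (c * F) (c * G)) =
      ncconst c * quad A B C D E F G"
    by (simp add: quad_def subst.eval_simps ncconst_simps distrib_left mult.assoc)
qed (simp_all add: subst.eval_simps assms)

text \<open>
  This substitution is not affine. The relation on the left reads \<open>b(xy - yx) = x + y\<^sup>2\<close>, and \<open>y\<close> has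
  the same commutator with \<open>x\<close> as with the new generator \<open>x + y\<^sup>2\<close>.
\<close>

lemma iso_absorb_square:
  "presented (quad 0 (- b) b 1 1 0 0) \<cong>\<^sub>a\<^sub>l\<^sub>g presented (quad 0 (- b) b 0 1 0 0)"
proof (rule iso_by_substitution)
  show "subst.eval (ncx - ncy * ncy) ncy (quad 0 (- b) b 1 1 0 0) =
      ncconst 1 * quad 0 (- b) b 0 1 0 0"
    by (simp add: quad_def subst.eval_simps nc_expand)
  show "subst.eval (ncx + ncy * ncy) ncy (ncx - ncy * ncy) = ncx"
    by (simp add: subst.eval_simps)
qed (simp_all add: subst.eval_simps)

definition has_normal_form :: "'k::field ncpoly \<Rightarrow> bool" where
  "has_normal_form f \<longleftrightarrow> (\<exists>n. admissible n \<and> presented f \<cong>\<^sub>a\<^sub>l\<^sub>g presented (relator n))"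

lemma has_normal_form_relator: "admissible n \<Longrightarrow> has_normal_form (relator n)"
  using presented_iso_refl by (auto simp: has_normal_form_def)

lemma has_normal_form_iso:
  "presented f \<cong>\<^sub>a\<^sub>l\<^sub>g presented g \<Longrightarrow> has_normal_form g \<Longrightarrow> has_normal_form f"
  using alg_iso_trans by (auto simp: has_normal_form_def)

lemma relator_quad:
  "relator (QPlane q) = quad 0 1 (- q) 0 0 0 0"
  "relator (QWeyl q) = quad 0 1 (- q) 0 0 0 (- 1)"
  "relator Jordan = quad 0 (- 1) 1 1 0 0 0"
  "relator Jordan1 = quad 0 (- 1) 1 1 0 0 1"
  "relator Envel = quad 0 (- 1) 1 0 0 1 0"
  "relator PolyX = quad 1 0 0 0 0 1 0"
  "relator Rx2 = quad 1 0 0 0 0 0 0"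
  "relator Rx2m1 = quad 1 0 0 0 0 0 (- 1)"
  "relator Ryx = quad 0 0 1 0 0 0 0"
  "relator Sone = quad 0 0 1 0 0 0 (- 1)"
  by (simp_all add: quad_def ncconst_simps power2_eq_square mult.assoc)

lemmas affine_step = has_normal_form_iso[OF iso_affine]
lemmas swap_step = has_normal_form_iso[OF iso_swap]
lemmas scale_step = has_normal_form_iso[OF iso_scale]

lemmas normal_qplane =
  has_normal_form_relator[of "QPlane _", unfolded relator_quad admissible.simps]
lemmas normal_qweyl =
  has_normal_form_relator[of "QWeyl _", unfolded relator_quad admissible.simps]
lemmas normal_jordan =
  has_normal_form_relator[of Jordan, unfolded relator_quad admissible.simps, OF TrueI]
lemmas normal_jordan1 =
  has_normal_form_relator[of Jordan1, unfolded relator_quad admissible.simps, OF TrueI]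
lemmas normal_envel =
  has_normal_form_relator[of Envel, unfolded relator_quad admissible.simps, OF TrueI]
lemmas normal_polyx =
  has_normal_form_relator[of PolyX, unfolded relator_quad admissible.simps, OF TrueI]
lemmas normal_rx2 =
  has_normal_form_relator[of Rx2, unfolded relator_quad admissible.simps, OF TrueI]
lemmas normal_rx2m1 =
  has_normal_form_relator[of Rx2m1, unfolded relator_quad admissible.simps, OF TrueI]
lemmas normal_ryx =
  has_normal_form_relator[of Ryx, unfolded relator_quad admissible.simps, OF TrueI]
lemmas normal_sone =
  has_normal_form_relator[of Sone, unfolded relator_quad admissible.simps, OF TrueI]

text \<open>
  If \<open>y\<close> occurs, the relation solves for it and the algebra is generated by \<open>x\<close>. Otherwise it is
  a quadratic equation for \<open>x\<close>, normalised by completing the square.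
\<close>

lemma normal_form_square:
  fixes E F G :: "'k::{alg_closed_field, field_char_0}"
  shows "has_normal_form (quad 1 0 0 0 E F G)"
proof (cases "F = 0")
  case False
  show ?thesis
    (* After the swap, the linear part E x + F y + G becomes the generator. *)
    apply (rule swap_step)
    apply (rule affine_step[where \<alpha> = "inverse F" and \<beta> = "- E / F" and \<gamma> = "- G / F"])
    using False apply simp
    apply (rule swap_step)
    using False normal_polyx by simp
next
  case F: True
  have const: "has_normal_form (quad 1 0 0 0 0 0 m)" for m :: 'k
  proof (cases "m = 0")
    case False
    obtain s where s: "s ^ 2 = - m" using nth_root_exists[of 2] by auto
    then have s0: "s \<noteq> 0" and ss: "s * s = - m" using False by (auto simp: power2_eq_square)
    show ?thesis
      apply (rule affine_step[OF s0, where \<beta> = 0 and \<gamma> = 0])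
      apply (rule scale_step[where c = "- inverse m"])
      using False normal_rx2m1 by (simp_all add: ss)
  qed (use normal_rx2 in simp)
  show ?thesis
    apply (rule affine_step[where \<alpha> = 1 and \<beta> = 0 and \<gamma> = "- E / 2"])
    using const by (simp_all add: F)
qed

text \<open>
  The linear terms are absorbed by the translations that complete \<open>yx + ex + fy\<close> to a product.
\<close>

lemma normal_form_yx:
  fixes E F G :: "'k::{alg_closed_field, field_char_0}"
  shows "has_normal_form (quad 0 0 1 0 E F G)"
proof -
  have const: "has_normal_form (quad 0 0 1 0 0 0 m)" for m :: 'k
  proof (cases "m = 0")
    case False
    show ?thesis
      apply (rule affine_step[where \<alpha> = "- m" and \<beta> = 0 and \<gamma> = 0])
      using False apply simp
      apply (rule scale_step[where c = "- inverse m"])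
      using False normal_sone by simp_all
  qed (use normal_ryx in simp)
  show ?thesis
    apply (rule affine_step[where \<alpha> = 1 and \<beta> = 0 and \<gamma> = "- F"], simp)
    apply (rule swap_step)
    apply (rule affine_step[where \<alpha> = 1 and \<beta> = 0 and \<gamma> = "- E"], simp)
    apply (rule swap_step)
    using const by simp
qed

text \<open>
  Translations change the coefficients of the linear terms by multiples of \<open>1 - q\<close>, so for \<open>q \<noteq> 1\<close>
  both can be removed.
\<close>

lemma normal_form_q:
  fixes E F G q :: "'k::{alg_closed_field, field_char_0}"
  assumes "q \<noteq> 0" "q \<noteq> 1"
  shows "has_normal_form (quad 0 1 (- q) 0 E F G)"
proof -
  have const: "has_normal_form (quad 0 1 (- q) 0 0 0 m)" for m :: 'k
  proof (cases "m = 0")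
    case False
    show ?thesis
      apply (rule affine_step[where \<alpha> = "- m" and \<beta> = 0 and \<gamma> = 0])
      using False apply simp
      apply (rule scale_step[where c = "- inverse m"])
      using False normal_qweyl assms by (simp_all flip: mult.assoc)
  qed (use normal_qplane assms in simp)
  have "1 - q \<noteq> 0" using assms by simp
  then show ?thesis
    apply -
    apply (rule affine_step[where \<alpha> = 1 and \<beta> = 0 and \<gamma> = "- F / (1 - q)"], simp)
    apply (rule swap_step)
    apply (rule affine_step[where \<alpha> = 1 and \<beta> = 0 and \<gamma> = "- E / (1 - q)"], simp)
    apply (rule swap_step)
    using const by (simp add: field_simps)
qed

text \<open>
  The commutator is invariant under translations. If the remainder is not constant, it can itself be
  taken as a generator, and its commutator with the other generator is a multiple of it.
\<close>

lemma normal_form_commutator: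
  fixes E F G :: "'k::{alg_closed_field, field_char_0}"
  shows "has_normal_form (quad 0 1 (- 1) 0 E F G)"
proof -
  have lin: "has_normal_form (quad 0 1 (- 1) 0 e k m)" if "e \<noteq> 0" for e k m :: 'k
    (* The right-hand side e x + k y + m of the commutator relation becomes the generator x. *)
    apply (rule affine_step[where \<alpha> = "inverse e" and \<beta> = "- k / e" and \<gamma> = "- m / e"])
    using that apply simp
    apply (rule swap_step)
    apply (rule affine_step[where \<alpha> = e and \<beta> = 0 and \<gamma> = 0])
    using that normal_envel by simp_all
  consider "E \<noteq> 0" | "E = 0" "F \<noteq> 0" | "E = 0" "F = 0" "G = 0" | "E = 0" "F = 0" "G \<noteq> 0" by blast
  then show ?thesis
  proof cases
    case 1
    then show ?thesis by (rule lin)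
  next
    case 2
    then show ?thesis
      apply -
      apply (rule swap_step)
      apply (rule scale_step[where c = "- 1"])
      using lin by simp_all
  next
    case 3
    then show ?thesis using normal_qplane[of 1] by simp
  next
    case 4
    then show ?thesis
      apply -
      apply (rule affine_step[where \<alpha> = "- G" and \<beta> = 0 and \<gamma> = 0], simp)
      apply (rule scale_step[where c = "- inverse G"])
      using normal_qweyl[of 1] by simp_all
  qed
qed

text \<open>
  Translating \<open>y\<close> removes the term in \<open>y\<close>, but no translation changes the term in \<open>x\<close>. If there is one, the
  algebra is not of Jordan type at all: absorbing \<open>y\<^sup>2\<close> leaves a commutator relation with linear
  right-hand side.
\<close>

lemma normal_form_jordan:
  fixes E F G :: "'k::{alg_closed_field, field_char_0}"
  shows "has_normal_form (quad 0 (- 1) 1 1 E F G)"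
proof (cases "E = 0")
  case True
  have const: "has_normal_form (quad 0 (- 1) 1 1 0 0 m)" for m :: 'k
  proof (cases "m = 0")
    case False
    obtain s where s: "s ^ 2 = m" using nth_root_exists[of 2] by auto
    then have s0: "s \<noteq> 0" and ss: "s * s = m" using False by (auto simp: power2_eq_square)
    show ?thesis
      apply (rule affine_step[OF s0, where \<beta> = 0 and \<gamma> = 0])
      apply (rule swap_step)
      apply (rule affine_step[OF s0, where \<beta> = 0 and \<gamma> = 0])
      apply (rule swap_step)
      apply (rule scale_step[where c = "inverse m"])
      using False normal_jordan1 by (simp_all add: ss)
  qed (use normal_jordan in simp)
  show ?thesis
    apply (rule swap_step)
    apply (rule affine_step[where \<alpha> = 1 and \<beta> = 0 and \<gamma> = "- F / 2"], simp)
    apply (rule swap_step)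
    using const by (simp add: True)
next
  case False
  show ?thesis
    (* Making the linear part equal to x prepares for absorbing the square. *)
    apply (rule affine_step[where \<alpha> = "inverse E" and \<beta> = "- F / E" and \<gamma> = "- G / E"])
    using False apply simp
    apply (rule has_normal_form_iso)
    using False iso_absorb_square[of "inverse E"] apply simp
    apply (rule scale_step[where c = "- E"])
    using False normal_form_commutator by simp_all
qed

text \<open>
  With no \<open>x\<^sup>2\<close> present, \<open>x \<mapsto> x + \<beta>y\<close> changes the coefficient of \<open>y\<^sup>2\<close> by \<open>\<beta>(B + C)\<close>. So \<open>y\<^sup>2\<close> can be
  removed unless \<open>B + C = 0\<close>, when the form is a commutator plus a multiple of \<open>y\<^sup>2\<close>.
\<close>

lemma normal_form_isotropic:
  fixes B C D E F G :: "'k::{alg_closed_field, field_char_0}"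
  assumes "B \<noteq> 0 \<or> C \<noteq> 0 \<or> D \<noteq> 0"
  shows "has_normal_form (quad 0 B C D E F G)"
proof -
  consider "B + C \<noteq> 0" | "B + C = 0" "B \<noteq> 0" "D = 0" | "B + C = 0" "B \<noteq> 0" "D \<noteq> 0"
    | "B = 0" "C = 0" "D \<noteq> 0" using assms by fastforce
  then show ?thesis
  proof cases
    case 1
    have "has_normal_form (quad 0 B C 0 e k m)" for e k m
    proof -
      consider "B = 0" "C \<noteq> 0" | "C = 0" "B \<noteq> 0" | "B \<noteq> 0" "C \<noteq> 0" using 1 by (cases "B = 0"; cases "C = 0") auto
      then show ?thesis
      proof cases
        case 1
        show ?thesis
          by (rule scale_step[where c = "inverse C"]) (use 1 normal_form_yx in simp_all)
      next
        case 2
        have "has_normal_form (quad 0 0 B 0 k e m)"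
          by (rule scale_step[where c = "inverse B"]) (use 2 normal_form_yx in simp_all)
        then show ?thesis by - (rule has_normal_form_iso[OF iso_swap], simp add: 2)
      next
        case 3
        have "has_normal_form (quad 0 1 (- (- C / B)) 0 (e / B) (k / B) (m / B))"
          using 3 \<open>B + C \<noteq> 0\<close>
          by (intro normal_form_q) (auto simp: field_simps eq_neg_iff_add_eq_0)
        then show ?thesis
          using 3 by - (rule has_normal_form_iso[OF iso_scale[where c = "inverse B"]],
            simp_all add: field_simps)
      qed
    qed
    then show ?thesis
      using 1 by - (rule has_normal_form_iso[OF iso_affine[where \<alpha> = 1 and \<beta> = "- D / (B + C)"
            and \<gamma> = 0]], simp_all)
  next
    case 2
    then have "C = - B" by (simp add: eq_neg_iff_add_eq_0 add.commute)
    show ?thesis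
      by (rule scale_step[where c = "inverse B"])
        (use 2 \<open>C = - B\<close> normal_form_commutator in simp_all)
  next
    case 3
    then have "C = - B" by (simp add: eq_neg_iff_add_eq_0 add.commute)
    show ?thesis
      apply (rule scale_step[where c = "inverse D"])
      using 3 apply simp
      apply (rule affine_step[where \<alpha> = "- D / B" and \<beta> = 0 and \<gamma> = 0])
      using 3 \<open>C = - B\<close> normal_form_jordan by simp_all
  next
    case 4
    show ?thesis
      apply (rule swap_step)
      apply (rule scale_step[where c = "inverse D"])
      using 4 normal_form_square by simp_all
  qed
qed

text \<open>
  The root \<open>t\<close> makes \<open>(1, t)\<close> an isotropic vector of the quadratic part.
\<close>

theorem normal_form_quad:
  fixes A B C D E F G :: "'k::{alg_closed_field, field_char_0}"
  assumes "A \<noteq> 0 \<or> B \<noteq> 0 \<or> C \<noteq> 0 \<or> D \<noteq> 0"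
  shows "has_normal_form (quad A B C D E F G)"
proof (cases "D = 0")
  case True
  with assms show ?thesis
    by - (rule has_normal_form_iso[OF iso_swap], auto intro!: normal_form_isotropic)
next
  case False
  have "degree [:A, B + C, D:] > 0" using False by simp
  then obtain t where "poly [:A, B + C, D:] t = 0" using alg_closed_imp_poly_has_root by blast
  then have t: "t * t * D + t * (C + B) + A = 0" by (simp add: algebra_simps)
  show ?thesis
    apply (rule swap_step)
    apply (rule affine_step[where \<alpha> = 1 and \<beta> = t and \<gamma> = 0], simp)
    apply (rule swap_step)
    using False by (simp add: t normal_form_isotropic)
qed

lemma short_words:
  assumes "length (letters w) \<le> 2"
  shows "w \<in> {Word [Letter_x, Letter_x], Word [Letter_x, Letter_y], Word [Letter_y, Letter_x],
    Word [Letter_y, Letter_y], Word [Letter_x], Word [Letter_y], Word []}"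
proof (cases w)
  case (Word l)
  have "z = Letter_x \<or> z = Letter_y" for z by (cases z) simp_all
  with assms Word show ?thesis
    by (cases l rule: remdups_adj.cases) (auto simp: length_Suc_conv le_Suc_eq numeral_2_eq_2)
qed

lemma lookup_quad:
  "Poly_Mapping.lookup (quad A B C D E F G) w =
    (if w = Word [Letter_x, Letter_x] then A else if w = Word [Letter_x, Letter_y] then B
     else if w = Word [Letter_y, Letter_x] then C else if w = Word [Letter_y, Letter_y] then D
     else if w = Word [Letter_x] then E else if w = Word [Letter_y] then F
     else if w = Word [] then G else 0)"
  by (simp add: quad_def ncx_def ncy_def ncconst_def mult_single plus_word_def zero_word_def
      lookup_add lookup_single when_def)

lemma degree_two_quad:
  assumes "ncdegree f = 2"
  obtains A B C D E F G where "f = quad A B C D E F G" "A \<noteq> 0 \<or> B \<noteq> 0 \<or> C \<noteq> 0 \<or> D \<noteq> 0"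
proof -
  let ?c = "\<lambda>l. Poly_Mapping.lookup f (Word l)"
  let ?len = "\<lambda>w. length (letters w)"
  have fin: "finite (insert 0 (?len ` Poly_Mapping.keys f))" by simp
  have len: "?len w \<le> 2" if "w \<in> Poly_Mapping.keys f" for w
  proof -
    have "?len w \<le> Max (insert 0 (?len ` Poly_Mapping.keys f))"
      by (rule Max_ge[OF fin]) (use that in simp)
    then show ?thesis using assms by (simp only: ncdegree_def)
  qed
  have "f = quad (?c [Letter_x, Letter_x]) (?c [Letter_x, Letter_y]) (?c [Letter_y, Letter_x])
      (?c [Letter_y, Letter_y]) (?c [Letter_x]) (?c [Letter_y]) (?c [])" (is "_ = ?q")
  proof (rule poly_mapping_eqI)
    fix w
    show "Poly_Mapping.lookup f w = Poly_Mapping.lookup ?q w"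
    proof (cases "w \<in> Poly_Mapping.keys f")
      case True
      then show ?thesis using short_words[OF len] by (fastforce simp: lookup_quad)
    qed (auto simp: lookup_quad in_keys_iff)
  qed
  moreover obtain w where w: "w \<in> Poly_Mapping.keys f" "?len w = 2"
  proof -
    have "2 \<in> insert 0 (?len ` Poly_Mapping.keys f)"
      using Max_in[OF fin] assms by (simp add: ncdegree_def)
    then show thesis using that by auto
  qed
  then have "?c [Letter_x, Letter_x] \<noteq> 0 \<or> ?c [Letter_x, Letter_y] \<noteq> 0 \<or>
      ?c [Letter_y, Letter_x] \<noteq> 0 \<or> ?c [Letter_y, Letter_y] \<noteq> 0"
    using short_words[OF len[OF w(1)]] by (auto simp: in_keys_iff)
  ultimately show thesis by (rule that)
qed

section \<open>Points of a presented algebra and extensions between them\<close>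

text \<open>
  Since a homomorphism to the field vanishes on the ideal generated by \<open>f\<close> as soon as it kills \<open>f\<close>,
  these are the one-dimensional representations of \<open>\<k>\<langle>x,y | f\<rangle>\<close>.
\<close>

definition points :: "'k::field ncpoly \<Rightarrow> ('k ncpoly \<Rightarrow> 'k) set" where
  "points f = {p. nc_hom (\<lambda>c. c) p \<and> p f = 0}"

abbreviation pt :: "'k::field \<Rightarrow> 'k \<Rightarrow> 'k ncpoly \<Rightarrow> 'k" where
  "pt \<equiv> point.eval"

lemma pt_in_points [simp]: "pt a b \<in> points f \<longleftrightarrow> pt a b f = 0"
  by (simp add: points_def point.eval_hom)

lemma pt_eq_iff [simp]: "pt a b = pt a' b' \<longleftrightarrow> a = a' \<and> b = b'"
  by (metis point.eval_x point.eval_y)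

lemma point_is_pt: "p \<in> points f \<Longrightarrow> p = pt (p ncx) (p ncy)"
  using point.hom_is_eval by (auto simp: points_def)

lemma points_cases:
  assumes "p \<in> points f"
  obtains a b where "p = pt a b" "pt a b f = 0"
  using point_is_pt[OF assms] assms by (metis pt_in_points)

definition derivation :: "('k::field ncpoly \<Rightarrow> 'k) \<Rightarrow> ('k ncpoly \<Rightarrow> 'k) \<Rightarrow> ('k ncpoly \<Rightarrow> 'k) \<Rightarrow> bool"
  where
  "derivation p p' \<delta> \<longleftrightarrow> (\<forall>a b. \<delta> (a + b) = \<delta> a + \<delta> b) \<and>
    (\<forall>a b. \<delta> (a * b) = p a * \<delta> b + \<delta> a * p' b) \<and> (\<forall>c. \<delta> (ncconst c) = 0)"

context
  fixes p p' \<delta> :: "'k::field ncpoly \<Rightarrow> 'k"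
  assumes \<delta>: "derivation p p' \<delta>"
begin

lemma derivation_simps:
  "\<delta> (a + b) = \<delta> a + \<delta> b" "\<delta> (a * b) = p a * \<delta> b + \<delta> a * p' b" "\<delta> (ncconst c) = 0"
  "\<delta> 1 = 0" "\<delta> (- a) = - \<delta> a" "\<delta> (a - b) = \<delta> a - \<delta> b"
proof -
  show add: "\<delta> (a + b) = \<delta> a + \<delta> b" for a b using \<delta> by (simp add: derivation_def)
  show "\<delta> (a * b) = p a * \<delta> b + \<delta> a * p' b" using \<delta> by (simp add: derivation_def)
  show const: "\<delta> (ncconst c) = 0" for c using \<delta> by (simp add: derivation_def)
  show "\<delta> 1 = 0" using const[of 1] by (simp add: ncconst_simps)
  have "\<delta> 0 = 0" using const[of 0] by (simp add: ncconst_simps)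
  then show minus: "\<delta> (- a) = - \<delta> a" for a
    using add[of a "- a"] by (simp add: minus_unique)
  show "\<delta> (a - b) = \<delta> a - \<delta> b" using add[of a "- b"] by (simp add: minus)
qed

lemma derivation_eqI:
  assumes "derivation p p' \<delta>'" "\<delta> ncx = \<delta>' ncx" "\<delta> ncy = \<delta>' ncy"
  shows "\<delta> a = \<delta>' a"
  using assms \<delta> by (induction a rule: ncpoly_induct) (simp_all add: derivation_def)

end

lemma derivation_zero: "derivation p p' (\<lambda>_. 0)"
  by (simp add: derivation_def)

lemma derivation_combination:
  "derivation p p' \<delta> \<Longrightarrow> derivation p p' \<delta>' \<Longrightarrow> derivation p p' (\<lambda>a. c * \<delta> a + d * \<delta>' a)"
  by (simp add: derivation_def algebra_simps)

text \<open>
  The two values on the generators can be prescribed freely, so the \<open>(p,p')\<close>-derivations of the free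
  algebra form a plane.
\<close>

lemma derivation_exists:
  obtains \<delta> where "derivation (pt a b) (pt a' b') \<delta>" "\<delta> ncx = u" "\<delta> ncy = v"
proof -
  define T where "T = triangular.eval (Tri a u a') (Tri b v b')"
  have T: "nc_hom tri_scalar T" by (simp add: T_def triangular.eval_hom)
  note T_simps = triangular.hom_simps[OF T]
  have gens: "T ncx = Tri a u a'" "T ncy = Tri b v b'" by (simp_all add: T_def)
  have "nc_hom (\<lambda>c. c) (ul \<circ> T)" "nc_hom (\<lambda>c. c) (lr \<circ> T)"
    by (simp_all add: nc_hom_def T_simps tri_scalar_def)
  then have "(ul \<circ> T) c = pt a b c" "(lr \<circ> T) c = pt a' b' c" for c
    using point.hom_is_eval[of "ul \<circ> T" c] point.hom_is_eval[of "lr \<circ> T" c] by (simp_all add: gens)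
  then have "derivation (pt a b) (pt a' b') (\<lambda>c. ur (T c))"
    by (simp add: derivation_def T_simps tri_scalar_def)
  then show thesis using that by (simp add: gens)
qed

text \<open>
  The derivations killing \<open>f\<close> are those of the quotient algebra. Two points are linked if they form the
  whole plane of derivations of the free algebra. This is phrased through an independent pair because
  such pairs are carried along by an isomorphism.
\<close>

definition linked :: "'k::field ncpoly \<Rightarrow> ('k ncpoly \<Rightarrow> 'k) \<Rightarrow> ('k ncpoly \<Rightarrow> 'k) \<Rightarrow> bool" where
  "linked f p p' \<longleftrightarrow> p \<in> points f \<and> p' \<in> points f \<and>
    (\<exists>\<delta> \<delta>'. derivation p p' \<delta> \<and> derivation p p' \<delta>' \<and> \<delta> f = 0 \<and> \<delta>' f = 0 \<and>
      (\<forall>c d. (\<forall>a. c * \<delta> a + d * \<delta>' a = 0) \<longrightarrow> c = 0 \<and> d = 0))"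

text \<open>
  By Cramer's rule an independent pair spans all derivations.
\<close>

lemma linked_iff:
  assumes p: "p \<in> points f" and p': "p' \<in> points f"
  shows "linked f p p' \<longleftrightarrow> (\<forall>\<delta>. derivation p p' \<delta> \<longrightarrow> \<delta> f = 0)"
proof
  assume "linked f p p'"
  then obtain \<delta>\<^sub>1 \<delta>\<^sub>2 where \<delta>: "derivation p p' \<delta>\<^sub>1" "derivation p p' \<delta>\<^sub>2"
    and f: "\<delta>\<^sub>1 f = 0" "\<delta>\<^sub>2 f = 0"
    and indep: "\<And>c d. (\<forall>a. c * \<delta>\<^sub>1 a + d * \<delta>\<^sub>2 a = 0) \<Longrightarrow> c = 0 \<and> d = 0"
    unfolding linked_def by blast
  (* Independence is detected on the generators: a vanishing determinant gives a dependence. *)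
  define \<Delta> where "\<Delta> = \<delta>\<^sub>1 ncx * \<delta>\<^sub>2 ncy - \<delta>\<^sub>1 ncy * \<delta>\<^sub>2 ncx"
  have dep: "c = 0 \<and> d = 0"
    if "c * \<delta>\<^sub>1 ncx + d * \<delta>\<^sub>2 ncx = 0" "c * \<delta>\<^sub>1 ncy + d * \<delta>\<^sub>2 ncy = 0" for c d
  proof (rule indep, rule allI)
    show "c * \<delta>\<^sub>1 a + d * \<delta>\<^sub>2 a = 0" for a
      using derivation_eqI[OF derivation_combination[OF \<delta>, of c d] derivation_zero, of a] that
      by simp
  qed
  have "\<Delta> \<noteq> 0"
  proof
    assume "\<Delta> = 0"
    then have "\<delta>\<^sub>2 ncx = 0 \<and> - \<delta>\<^sub>1 ncx = 0" "\<delta>\<^sub>2 ncy = 0 \<and> - \<delta>\<^sub>1 ncy = 0"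
      by (intro dep; simp add: \<Delta>_def algebra_simps)+
    then show False using dep[of 1 1] by simp
  qed
  show "\<forall>\<delta>. derivation p p' \<delta> \<longrightarrow> \<delta> f = 0"
  proof (intro allI impI)
    fix \<delta> assume \<delta>': "derivation p p' \<delta>"
    let ?c = "(\<delta> ncx * \<delta>\<^sub>2 ncy - \<delta> ncy * \<delta>\<^sub>2 ncx) / \<Delta>"
    let ?d = "(\<delta>\<^sub>1 ncx * \<delta> ncy - \<delta>\<^sub>1 ncy * \<delta> ncx) / \<Delta>"
    have eqs: "?c * \<delta>\<^sub>1 ncx + ?d * \<delta>\<^sub>2 ncx = \<delta> ncx * \<Delta> / \<Delta>"
      "?c * \<delta>\<^sub>1 ncy + ?d * \<delta>\<^sub>2 ncy = \<delta> ncy * \<Delta> / \<Delta>"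
      by (simp_all add: \<Delta>_def algebra_simps flip: add_divide_distrib)
    have "\<delta> f = ?c * \<delta>\<^sub>1 f + ?d * \<delta>\<^sub>2 f"
      using eqs[unfolded nonzero_mult_div_cancel_right[OF \<open>\<Delta> \<noteq> 0\<close>], symmetric]
      by (rule derivation_eqI[OF \<delta>' derivation_combination[OF \<delta>, of ?c ?d]])
    then show "\<delta> f = 0" by (simp add: f)
  qed
next
  assume all: "\<forall>\<delta>. derivation p p' \<delta> \<longrightarrow> \<delta> f = 0"
  obtain a b a' b' where pp': "p = pt a b" "p' = pt a' b'"
    using points_cases[OF p] points_cases[OF p'] by metis
  obtain \<delta> where \<delta>: "derivation p p' \<delta>" "\<delta> ncx = 1" "\<delta> ncy = 0"
    unfolding pp' by (rule derivation_exists)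
  obtain \<delta>' where \<delta>': "derivation p p' \<delta>'" "\<delta>' ncx = 0" "\<delta>' ncy = 1"
    unfolding pp' by (rule derivation_exists)
  have "c = 0 \<and> d = 0" if "\<forall>a. c * \<delta> a + d * \<delta>' a = 0" for c d
    using that[rule_format, of ncx] that[rule_format, of ncy] \<delta> \<delta>' by simp
  then show "linked f p p'" using p p' \<delta> \<delta>' all unfolding linked_def by blast
qed

lemma points_vanish:
  assumes "p \<in> points g" "a \<in> rel_ideal g"
  shows "p a = 0"
proof -
  have "nc_hom (\<lambda>c. c) p" "p g = 0" using assms by (simp_all add: points_def)
  then have "rel_ideal g \<subseteq> {a. p a = 0}"
    by (intro rel_ideal_minimal) (simp_all add: point.hom_simps)
  then show ?thesis using assms by blast
qed

context
  fixes f g :: "'k::field ncpoly" and \<phi> \<psi>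
  assumes inv: "inverse_substitutions f g \<phi> \<psi>"
begin

lemma pull_point: "p \<in> points g \<Longrightarrow> p \<circ> \<phi> \<in> points f"
  using inv points_vanish[of p g "\<phi> f"]
  by (auto simp: points_def inverse_substitutions_def nc_hom_def)

lemma pull_push_point: "p \<in> points g \<Longrightarrow> p (\<phi> (\<psi> a)) = p a"
  using inv points_vanish[of p g "\<phi> (\<psi> a) - a"]
  by (auto simp: inverse_substitutions_def points_def point.hom_simps)

end

lemma derivation_vanish:
  assumes "p \<in> points g" "p' \<in> points g" "derivation p p' \<delta>" "\<delta> g = 0" "a \<in> rel_ideal g"
  shows "\<delta> a = 0"
proof -
  have "rel_ideal g \<subseteq> {a. p a = 0 \<and> p' a = 0 \<and> \<delta> a = 0}"
    using assms by (intro rel_ideal_minimal)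
      (auto simp: points_def point.hom_simps derivation_simps)
  then show ?thesis using assms by blast
qed

text \<open>
  Precomposition with \<open>\<phi>\<close> keeps a pair of derivations independent, since precomposing further with
  \<open>\<psi>\<close> gives the pair back.
\<close>

lemma pull_linked:
  assumes inv: "inverse_substitutions f g \<phi> \<psi>" and link: "linked g p p'"
  shows "linked f (p \<circ> \<phi>) (p' \<circ> \<phi>)"
proof -
  from link obtain \<delta>\<^sub>1 \<delta>\<^sub>2 where p: "p \<in> points g" "p' \<in> points g"
    and \<delta>: "derivation p p' \<delta>\<^sub>1" "derivation p p' \<delta>\<^sub>2" "\<delta>\<^sub>1 g = 0" "\<delta>\<^sub>2 g = 0"
    and indep: "\<And>c d. (\<forall>a. c * \<delta>\<^sub>1 a + d * \<delta>\<^sub>2 a = 0) \<Longrightarrow> c = 0 \<and> d = 0"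
    unfolding linked_def by blast
  have \<phi>: "nc_hom ncconst \<phi>" "\<phi> f \<in> rel_ideal g" "\<And>a. \<phi> (\<psi> a) - a \<in> rel_ideal g"
    using inv by (auto simp: inverse_substitutions_def)
  have pull: "derivation (p \<circ> \<phi>) (p' \<circ> \<phi>) (\<delta> \<circ> \<phi>) \<and> (\<delta> \<circ> \<phi>) f = 0 \<and> (\<forall>a. \<delta> (\<phi> (\<psi> a)) = \<delta> a)"
    if "derivation p p' \<delta>" "\<delta> g = 0" for \<delta>
    using that derivation_vanish[OF p that \<phi>(2)] derivation_vanish[OF p that \<phi>(3)]
      derivation_simps[OF that(1)]
    by (simp add: derivation_def subst.hom_simps[OF \<phi>(1)])
  have "c = 0 \<and> d = 0" if eq: "\<forall>a. c * (\<delta>\<^sub>1 \<circ> \<phi>) a + d * (\<delta>\<^sub>2 \<circ> \<phi>) a = 0" for c d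
  proof (intro indep allI)
    show "c * \<delta>\<^sub>1 a + d * \<delta>\<^sub>2 a = 0" for a
      using eq[rule_format, of "\<psi> a"] pull[OF \<delta>(1,3)] pull[OF \<delta>(2,4)] by simp
  qed
  then show ?thesis
    unfolding linked_def using pull[OF \<delta>(1,3)] pull[OF \<delta>(2,4)] pull_point[OF inv p(1)]
      pull_point[OF inv p(2)] by blast
qed

section \<open>The points of the normal forms\<close>

fun on_curve :: "'k::field normal_form \<Rightarrow> 'k \<Rightarrow> 'k \<Rightarrow> bool" where
  "on_curve (QPlane q) a b \<longleftrightarrow> (1 - q) * (a * b) = 0"
| "on_curve (QWeyl q) a b \<longleftrightarrow> (1 - q) * (a * b) = 1"
| "on_curve Jordan a b \<longleftrightarrow> b = 0"
| "on_curve Jordan1 a b \<longleftrightarrow> b * b = - 1"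
| "on_curve Envel a b \<longleftrightarrow> b = 0"
| "on_curve PolyX a b \<longleftrightarrow> b = - a * a"
| "on_curve Rx2 a b \<longleftrightarrow> a = 0"
| "on_curve Rx2m1 a b \<longleftrightarrow> a * a = 1"
| "on_curve Ryx a b \<longleftrightarrow> a * b = 0"
| "on_curve Sone a b \<longleftrightarrow> a * b = 1"

text \<open>
  The coefficients of the equation \<open>\<alpha>u + \<beta>v = 0\<close> for a derivation between \<open>(a,b)\<close> and \<open>(a',b')\<close> with
  values \<open>u\<close>, \<open>v\<close> at the generators: \<open>\<alpha>\<close> and \<open>\<beta>\<close> are the Fox derivatives of the relator by
  \<open>x\<close> and \<open>y\<close>, evaluated at \<open>(a,b)\<close> to the left and at \<open>(a',b')\<close> to the right of the
  differentiated letter.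
\<close>

fun fox_x :: "'k::field normal_form \<Rightarrow> 'k \<Rightarrow> 'k \<Rightarrow> 'k \<Rightarrow> 'k \<Rightarrow> 'k" where
  "fox_x (QPlane q) a b a' b' = b' - q * b"
| "fox_x (QWeyl q) a b a' b' = b' - q * b"
| "fox_x Jordan a b a' b' = b - b'"
| "fox_x Jordan1 a b a' b' = b - b'"
| "fox_x Envel a b a' b' = b - b'"
| "fox_x PolyX a b a' b' = a + a'"
| "fox_x Rx2 a b a' b' = a + a'"
| "fox_x Rx2m1 a b a' b' = a + a'"
| "fox_x Ryx a b a' b' = b"
| "fox_x Sone a b a' b' = b"

fun fox_y :: "'k::field normal_form \<Rightarrow> 'k \<Rightarrow> 'k \<Rightarrow> 'k \<Rightarrow> 'k \<Rightarrow> 'k" where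
  "fox_y (QPlane q) a b a' b' = a - q * a'"
| "fox_y (QWeyl q) a b a' b' = a - q * a'"
| "fox_y Jordan a b a' b' = a' - a + b + b'"
| "fox_y Jordan1 a b a' b' = a' - a + b + b'"
| "fox_y Envel a b a' b' = a' - a + 1"
| "fox_y PolyX a b a' b' = 1"
| "fox_y Rx2 a b a' b' = 0"
| "fox_y Rx2m1 a b a' b' = 0"
| "fox_y Ryx a b a' b' = a'"
| "fox_y Sone a b a' b' = a'"

lemma pt_relator: "pt a b (relator n) = 0 \<longleftrightarrow> on_curve n a b"
  by (cases n)
    (auto simp: point.eval_simps power2_eq_square algebra_simps eq_neg_iff_add_eq_0)

lemma derivation_relator:
  assumes "derivation (pt a b) (pt a' b') \<delta>"
  shows "\<delta> (relator n) = fox_x n a b a' b' * \<delta> ncx + fox_y n a b a' b' * \<delta> ncy"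
  by (cases n) (simp_all add: derivation_simps[OF assms] point.eval_simps power2_eq_square algebra_simps)

lemma linked_relator:
  "linked (relator n) (pt a b) (pt a' b') \<longleftrightarrow>
    on_curve n a b \<and> on_curve n a' b' \<and> fox_x n a b a' b' = 0 \<and> fox_y n a b a' b' = 0"
proof (cases "on_curve n a b \<and> on_curve n a' b'")
  case True
  then have *: "linked (relator n) (pt a b) (pt a' b') \<longleftrightarrow>
      (\<forall>\<delta>. derivation (pt a b) (pt a' b') \<delta> \<longrightarrow> fox_x n a b a' b' * \<delta> ncx + fox_y n a b a' b' * \<delta> ncy = 0)"
    using linked_iff[of "pt a b" "relator n" "pt a' b'"]
    by (simp add: pt_relator derivation_relator cong: imp_cong)
  obtain \<delta> \<delta>' where "derivation (pt a b) (pt a' b') \<delta>" "\<delta> ncx = 1" "\<delta> ncy = 0"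
    "derivation (pt a b) (pt a' b') \<delta>'" "\<delta>' ncx = 0" "\<delta>' ncy = 1"
    by (metis derivation_exists)
  then show ?thesis unfolding * using True by fastforce
qed (auto simp: linked_def pt_relator)

lemma linked_relator_cases:
  assumes "linked (relator n) p p'"
  obtains a b a' b' where "p = pt a b" "p' = pt a' b'" "on_curve n a b" "on_curve n a' b'"
    "fox_x n a b a' b' = 0" "fox_y n a b a' b' = 0"
proof -
  have "p \<in> points (relator n)" "p' \<in> points (relator n)" using assms by (simp_all add: linked_def)
  then obtain a b a' b' where "p = pt a b" "p' = pt a' b'" by (metis points_cases)
  then show thesis using that assms by (simp add: linked_relator)
qed

section \<open>Recognising the normal form from the points\<close>

text \<open>
  On a curve parametrised by polynomials every element of the algebra becomes a polynomial in the
  parameter.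
\<close>

lemma pt_on_curve: "pt (poly r t) (poly s t) a = poly (curve.eval r s a) t"
proof -
  have "nc_hom (\<lambda>c. c) (\<lambda>a. poly (curve.eval r s a) t)"
    by (simp add: nc_hom_def curve.eval_simps)
  from point.hom_is_eval[OF this, of a] show ?thesis by simp
qed

text \<open>
  Hence along an affine line in the curve, a function that omits a value is constant.
\<close>

lemma poly_constant_or_surj:
  fixes P :: "'k::alg_closed_field poly"
  obtains "\<And>t. poly P t = poly P 0" | "\<And>c. \<exists>t. poly P t = c"
proof (cases "degree P = 0")
  case True
  then show thesis using that(1) by (metis degree_eq_zeroE poly_pCons mult_zero_right poly_0)
next
  case False
  have "\<exists>t. poly P t = c" for c
  proof -
    have "degree (P + [:- c:]) > 0" using False by (simp add: degree_add_eq_left)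
    then obtain t where "poly (P + [:- c:]) t = 0" using alg_closed_imp_poly_has_root by blast
    then show ?thesis by auto
  qed
  then show thesis by (rule that(2))
qed

text \<open>
  The first two invariants depend only on the functions on the set of points. The others describe the
  relation of being linked as a directed graph: whether it has edges, edges that are not loops, vertices
  with several successors, and loops at all or some vertices.
\<close>

definition nonconstant_unit :: "'k::field ncpoly \<Rightarrow> bool" where
  "nonconstant_unit f \<longleftrightarrow> (\<exists>a. (\<forall>p\<in>points f. p a \<noteq> 0) \<and> (\<exists>p\<in>points f. \<exists>p'\<in>points f. p a \<noteq> p' a))"

definition points_separated :: "'k::field ncpoly \<Rightarrow> bool" where
  "points_separated f \<longleftrightarrow> (\<exists>a. inj_on (\<lambda>p. p a) (points f))"

definition some_link :: "'k::field ncpoly \<Rightarrow> bool" where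
  "some_link f \<longleftrightarrow> (\<exists>p p'. linked f p p')"

definition proper_link :: "'k::field ncpoly \<Rightarrow> bool" where
  "proper_link f \<longleftrightarrow> (\<exists>p p'. linked f p p' \<and> p \<noteq> p')"

definition branching_link :: "'k::field ncpoly \<Rightarrow> bool" where
  "branching_link f \<longleftrightarrow> (\<exists>p p' p''. linked f p p' \<and> linked f p p'' \<and> p' \<noteq> p'')"

definition all_self_linked :: "'k::field ncpoly \<Rightarrow> bool" where
  "all_self_linked f \<longleftrightarrow> (\<forall>p\<in>points f. linked f p p)"

definition some_self_linked :: "'k::field ncpoly \<Rightarrow> bool" where
  "some_self_linked f \<longleftrightarrow> (\<exists>p. linked f p p)"

text \<open>
  The map \<open>p \<mapsto> p \<circ> \<phi>\<close> is a bijection between the sets of points with inverse \<open>p \<mapsto> p \<circ> \<psi>\<close>, it maps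
  links to links, and the function given by \<open>a\<close> corresponds to the one given by \<open>\<phi> a\<close>. Each
  implication is stated in the direction in which this map proves it; exchanging \<open>\<phi>\<close> and \<open>\<psi>\<close>
  gives the converses.
\<close>

lemma invariants_mono:
  fixes f g :: "'k::field ncpoly"
  assumes inv: "inverse_substitutions f g \<phi> \<psi>"
  shows "points g \<noteq> {} \<Longrightarrow> points f \<noteq> {}"
    "nonconstant_unit f \<Longrightarrow> nonconstant_unit g"
    "points_separated f \<Longrightarrow> points_separated g"
    "some_link g \<Longrightarrow> some_link f"
    "proper_link g \<Longrightarrow> proper_link f"
    "branching_link g \<Longrightarrow> branching_link f"
    "all_self_linked g \<Longrightarrow> all_self_linked f"
    "some_self_linked g \<Longrightarrow> some_self_linked f"
proof -
  have inv': "inverse_substitutions g f \<psi> \<phi>" by (rule inverse_substitutions_sym[OF inv])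
  note pull = pull_point[OF inv] and push = pull_point[OF inv']
    and link = pull_linked[OF inv]
  have push_pull: "p \<circ> \<psi> \<circ> \<phi> = p" if "p \<in> points f" for p
    using pull_push_point[OF inv' that] by (simp add: fun_eq_iff)
  have pull_push: "p \<circ> \<phi> \<circ> \<psi> = p" if "p \<in> points g" for p
    using pull_push_point[OF inv that] by (simp add: fun_eq_iff)
  have distinct: "p \<circ> \<phi> \<noteq> p' \<circ> \<phi>" if "p \<noteq> p'" "p \<in> points g" "p' \<in> points g" for p p'
    using pull_push that by metis
  have linked_points: "p \<in> points g" "p' \<in> points g" if "linked g p p'" for p p'
    using that by (simp_all add: linked_def)
  show "points g \<noteq> {} \<Longrightarrow> points f \<noteq> {}" using pull by blast
  show "nonconstant_unit g" if unit: "nonconstant_unit f"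
  proof -
    obtain a p p' where a: "\<forall>p\<in>points f. p a \<noteq> 0" and p: "p \<in> points f" "p' \<in> points f" "p a \<noteq> p' a"
      using unit unfolding nonconstant_unit_def by blast
    have "\<forall>p\<in>points g. p (\<phi> a) \<noteq> 0" using a pull by (metis comp_apply)
    moreover have "(p \<circ> \<psi>) (\<phi> a) \<noteq> (p' \<circ> \<psi>) (\<phi> a)" using p push_pull by (metis comp_apply)
    ultimately show ?thesis unfolding nonconstant_unit_def using push p(1,2) by blast
  qed
  show "points_separated g" if sep: "points_separated f"
  proof -
    obtain a where a: "inj_on (\<lambda>p. p a) (points f)" using sep unfolding points_separated_def by blast
    have "inj_on (\<lambda>p. p (\<phi> a)) (points g)"
    proof (rule inj_onI)
      fix p p' assume p: "p \<in> points g" "p' \<in> points g" "p (\<phi> a) = p' (\<phi> a)"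
      then have "p \<circ> \<phi> = p' \<circ> \<phi>" by (intro inj_onD[OF a] pull) simp_all
      then show "p = p'" using distinct p by blast
    qed
    then show ?thesis unfolding points_separated_def by blast
  qed
  show "some_link g \<Longrightarrow> some_link f" unfolding some_link_def using link by blast
  show "proper_link g \<Longrightarrow> proper_link f"
    unfolding proper_link_def using link distinct linked_points by blast
  show "branching_link g \<Longrightarrow> branching_link f"
    unfolding branching_link_def using link distinct linked_points by blast
  show "all_self_linked g \<Longrightarrow> all_self_linked f"
    unfolding all_self_linked_def using link push push_pull by (metis (no_types, lifting))
  show "some_self_linked g \<Longrightarrow> some_self_linked f" unfolding some_self_linked_def using link by blast
qed

text \<open>
  A decision tree separating the families. The quantum plane and the quantum Weyl algebra with \<open>q \<noteq> 1\<close>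
  are reported with the parameter \<open>0\<close>, which no admissible normal form has; those with \<open>q = 1\<close>, the
  polynomial ring in two variables and the Weyl algebra, differ from them in the shape of the graph.
\<close>

definition recognise :: "'k::field ncpoly \<Rightarrow> 'k normal_form" where
  "recognise f =
    (if points f = {} then QWeyl 1
     else if \<not> some_link f then if nonconstant_unit f then Sone else PolyX
     else if \<not> proper_link f then if points_separated f then Jordan else QPlane 1
     else if branching_link f then
       if all_self_linked f then Rx2 else if some_self_linked f then Ryx else Rx2m1
     else if some_self_linked f then QPlane 0
     else if \<not> points_separated f then Jordan1
     else if nonconstant_unit f then QWeyl 0 else Envel)"

lemma recognise_iso:
  assumes "presented f \<cong>\<^sub>a\<^sub>l\<^sub>g presented g"
  shows "recognise f = recognise g"
proof -
  obtain \<phi> \<psi> where inv: "inverse_substitutions f g \<phi> \<psi>" using assms by (auto simp: presented_iso_iff)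
  note mono = invariants_mono[OF inv] invariants_mono[OF inverse_substitutions_sym[OF inv]]
  have "points f = {} \<longleftrightarrow> points g = {}" "nonconstant_unit f \<longleftrightarrow> nonconstant_unit g"
    "points_separated f \<longleftrightarrow> points_separated g" "some_link f \<longleftrightarrow> some_link g"
    "proper_link f \<longleftrightarrow> proper_link g" "branching_link f \<longleftrightarrow> branching_link g"
    "all_self_linked f \<longleftrightarrow> all_self_linked g" "some_self_linked f \<longleftrightarrow> some_self_linked g"
    using mono by blast+
  then show ?thesis by (simp add: recognise_def)
qed

text \<open>
  The answer of \<open>recognise\<close> on the relators.
\<close>

fun kind :: "'k::field normal_form \<Rightarrow> 'k normal_form" where
  "kind (QPlane q) = QPlane (if q = 1 then 1 else 0)"
| "kind (QWeyl q) = QWeyl (if q = 1 then 1 else 0)"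
| "kind n = n"

lemma relator_points_ex: "(\<exists>p\<in>points (relator n). P p) \<longleftrightarrow> (\<exists>a b. on_curve n a b \<and> P (pt a b))"
  by (metis points_cases pt_in_points pt_relator)

lemma relator_points_all: "(\<forall>p\<in>points (relator n). P p) \<longleftrightarrow> (\<forall>a b. on_curve n a b \<longrightarrow> P (pt a b))"
  using relator_points_ex[of n "\<lambda>p. \<not> P p"] by blast

lemma points_relator_empty: "points (relator n) = {} \<longleftrightarrow> (\<nexists>a b. on_curve n a b)"
  using relator_points_ex[of n "\<lambda>_. True"] by blast

lemma some_link_relator:
  "some_link (relator n) \<longleftrightarrow> (\<exists>a b a' b'. on_curve n a b \<and> on_curve n a' b' \<and>
    fox_x n a b a' b' = 0 \<and> fox_y n a b a' b' = 0)"
  unfolding some_link_def by (metis linked_relator linked_relator_cases)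

lemma proper_link_relator:
  "proper_link (relator n) \<longleftrightarrow> (\<exists>a b a' b'. on_curve n a b \<and> on_curve n a' b' \<and>
    fox_x n a b a' b' = 0 \<and> fox_y n a b a' b' = 0 \<and> (a \<noteq> a' \<or> b \<noteq> b'))"
proof
  assume "proper_link (relator n)"
  then obtain p p' where link: "linked (relator n) p p'" and "p \<noteq> p'" by (auto simp: proper_link_def)
  from link show "\<exists>a b a' b'. on_curve n a b \<and> on_curve n a' b' \<and>
      fox_x n a b a' b' = 0 \<and> fox_y n a b a' b' = 0 \<and> (a \<noteq> a' \<or> b \<noteq> b')"
    by (rule linked_relator_cases) (use \<open>p \<noteq> p'\<close> in blast)
qed (unfold proper_link_def, metis linked_relator pt_eq_iff)

lemma branching_link_relator:
  "branching_link (relator n) \<longleftrightarrow> (\<exists>a b a' b' a'' b''. on_curve n a b \<and> on_curve n a' b' \<and>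
    on_curve n a'' b'' \<and> fox_x n a b a' b' = 0 \<and> fox_y n a b a' b' = 0 \<and>
    fox_x n a b a'' b'' = 0 \<and> fox_y n a b a'' b'' = 0 \<and> (a' \<noteq> a'' \<or> b' \<noteq> b''))" (is "_ \<longleftrightarrow> ?R")
proof
  assume "branching_link (relator n)"
  then obtain p p' p'' where link: "linked (relator n) p p'" "linked (relator n) p p''" "p' \<noteq> p''"
    by (auto simp: branching_link_def)
  from link(1) obtain a b a' b' where 1: "p = pt a b" "p' = pt a' b'" "on_curve n a b" "on_curve n a' b'"
    "fox_x n a b a' b' = 0" "fox_y n a b a' b' = 0" by (rule linked_relator_cases)
  from link(2) obtain c d a'' b'' where "p = pt c d" "p'' = pt a'' b''" "on_curve n a'' b''"
    "fox_x n c d a'' b'' = 0" "fox_y n c d a'' b'' = 0" by (rule linked_relator_cases)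
  with 1 link(3) show ?R by (metis pt_eq_iff)
qed (unfold branching_link_def, metis linked_relator pt_eq_iff)

lemma self_linked_relator:
  "all_self_linked (relator n) \<longleftrightarrow>
    (\<forall>a b. on_curve n a b \<longrightarrow> fox_x n a b a b = 0 \<and> fox_y n a b a b = 0)"
  "some_self_linked (relator n) \<longleftrightarrow>
    (\<exists>a b. on_curve n a b \<and> fox_x n a b a b = 0 \<and> fox_y n a b a b = 0)"
proof -
  show "all_self_linked (relator n) \<longleftrightarrow>
      (\<forall>a b. on_curve n a b \<longrightarrow> fox_x n a b a b = 0 \<and> fox_y n a b a b = 0)"
    by (simp add: all_self_linked_def relator_points_all linked_relator)
  show "some_self_linked (relator n) \<longleftrightarrow>
      (\<exists>a b. on_curve n a b \<and> fox_x n a b a b = 0 \<and> fox_y n a b a b = 0)"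
    unfolding some_self_linked_def by (metis linked_relator linked_relator_cases pt_eq_iff)
qed

lemma nonconstant_unit_relator:
  "nonconstant_unit (relator n) \<longleftrightarrow> (\<exists>c. (\<forall>a b. on_curve n a b \<longrightarrow> pt a b c \<noteq> 0) \<and>
    (\<exists>a b a' b'. on_curve n a b \<and> on_curve n a' b' \<and> pt a b c \<noteq> pt a' b' c))"
  unfolding nonconstant_unit_def relator_points_all relator_points_ex by blast

lemma points_separated_relator:
  "points_separated (relator n) \<longleftrightarrow> (\<exists>c. \<forall>a b a' b'. on_curve n a b \<longrightarrow> on_curve n a' b' \<longrightarrow>
    pt a b c = pt a' b' c \<longrightarrow> a = a' \<and> b = b')"
  unfolding points_separated_def inj_on_def relator_points_all by simp

text \<open>
  If the points form the graph of a polynomial, then a function without zeros is constant.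
\<close>

lemma no_nonconstant_unit:
  fixes s :: "'k::alg_closed_field poly"
  assumes "\<And>a b. on_curve n a b \<longleftrightarrow> b = poly s a"
  shows "\<not> nonconstant_unit (relator n)"
proof
  assume "nonconstant_unit (relator n)"
  then obtain c a a' where c: "\<And>a. pt a (poly s a) c \<noteq> 0" "pt a (poly s a) c \<noteq> pt a' (poly s a') c"
    unfolding nonconstant_unit_relator assms by blast
  have "pt t (poly s t) c = poly (curve.eval [:0, 1:] s c) t" for t
    using pt_on_curve[of "[:0, 1:]" t s c] by simp
  with c show False
    using poly_constant_or_surj[of "curve.eval [:0, 1:] s c"] by metis
qed

text \<open>
  A function injective on two disjoint lines would be nonconstant on both, hence vanish on both.
\<close>

lemma not_points_separated:
  fixes d d' :: "'k::alg_closed_field"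
  assumes "\<And>a. on_curve n a d" "\<And>a. on_curve n a d'" "d \<noteq> d'"
  shows "\<not> points_separated (relator n)"
proof
  assume "points_separated (relator n)"
  then obtain c where c: "\<And>a b a' b'. on_curve n a b \<Longrightarrow> on_curve n a' b' \<Longrightarrow>
      pt a b c = pt a' b' c \<Longrightarrow> a = a' \<and> b = b'"
    unfolding points_separated_relator by blast
  have surj: "\<exists>t. pt t e c = 0" if e: "\<And>a. on_curve n a e" for e
  proof -
    have line: "pt t e c = poly (curve.eval [:0, 1:] [:e:] c) t" for t
      using pt_on_curve[of "[:0, 1:]" t "[:e:]" c] by simp
    have "pt 1 e c \<noteq> pt 0 e c" using c[OF e e, of 1 0] by auto
    then show ?thesis
      using poly_constant_or_surj[of "curve.eval [:0, 1:] [:e:] c"] by (metis line)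
  qed
  from surj[OF assms(1)] surj[OF assms(2)] show False
    using c[OF assms(1,2)] \<open>d \<noteq> d'\<close> by metis
qed

lemma nonconstant_unit_x:
  assumes "\<And>a b. on_curve n a b \<Longrightarrow> a \<noteq> 0" "on_curve n a b" "on_curve n a' b'" "a \<noteq> a'"
  shows "nonconstant_unit (relator n)"
  unfolding nonconstant_unit_relator by (rule exI[of _ ncx]) (use assms in auto)

lemma points_separated_x:
  assumes "\<And>a b b'. on_curve n a b \<Longrightarrow> on_curve n a b' \<Longrightarrow> b = b'"
  shows "points_separated (relator n)"
  unfolding points_separated_relator by (rule exI[of _ ncx]) (use assms in auto)

declare relator.simps [simp del]

lemmas link_simps = points_relator_empty some_link_relator proper_link_relator
  branching_link_relator self_linked_relator

text \<open>
  The links are, by the vanishing of the Fox derivatives: from \<open>(a,b)\<close> to \<open>(a/q, qb)\<close> on the quantum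
  plane and the quantum Weyl algebra; the loops for \<open>\<J>\<close>; from \<open>(a,b)\<close> to \<open>(a - 2b, b)\<close> for \<open>\<J>\<^sub>1\<close>; from
  \<open>(a,0)\<close> to \<open>(a - 1, 0)\<close> for \<open>\<UU>\<close>; none for \<open>\<k>[x]\<close> and \<open>\<S>\<close>; all pairs for \<open>x\<^sup>2\<close>; from \<open>(a,b)\<close> to
  any \<open>(-a,b')\<close> for \<open>x\<^sup>2 - 1\<close>; from any \<open>(a,0)\<close> to any \<open>(0,b')\<close> for \<open>yx\<close>. The families with the same
  kind of graph differ in the curve: a line, a plane, a cross, a hyperbola or two parallel lines.
\<close>

theorem recognise_relator:
  fixes n :: "'k::{alg_closed_field, field_char_0} normal_form"
  assumes "admissible n"
  shows "recognise (relator n) = kind n"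
proof (cases n)
  case (QPlane q)
  show ?thesis
  proof (cases "q = 1")
    case True
    have "\<not> points_separated (relator n)"
      by (rule not_points_separated[of n 0 1]) (simp_all add: QPlane True)
    then show ?thesis using True QPlane
      by (auto simp: recognise_def link_simps)
  next
    case False
    have nz: "q \<noteq> 0" using assms QPlane by simp
    have "points (relator n) \<noteq> {}" "some_link (relator n)" "some_self_linked (relator n)"
      by (auto simp: QPlane link_simps intro!: exI[of _ 0])
    moreover have "proper_link (relator n)" unfolding link_simps QPlane
      by (rule exI[of _ q], rule exI[of _ 0], rule exI[of _ 1], rule exI[of _ 0])
        (use False in simp)
    moreover have "\<not> branching_link (relator n)" using nz by (auto simp: QPlane link_simps)
    ultimately show ?thesis by (simp add: recognise_def QPlane False)
  qed
next
  case (QWeyl q)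
  show ?thesis
  proof (cases "q = 1")
    case True
    then show ?thesis using QWeyl by (auto simp: recognise_def link_simps)
  next
    case False
    have nz: "q \<noteq> 0" using assms QWeyl by simp
    have q1: "1 - q \<noteq> 0" using False by simp
    define \<kappa> where "\<kappa> = inverse (1 - q)"
    have curve: "on_curve n a (\<kappa> / a)" if "a \<noteq> 0" for a
      using that q1 by (simp add: QWeyl \<kappa>_def)
    have "points (relator n) \<noteq> {}" using curve[of 1] by (auto simp: link_simps)
    moreover have link: "proper_link (relator n)" unfolding link_simps
      by (rule exI[of _ q], rule exI[of _ "\<kappa> / q"], rule exI[of _ 1], rule exI[of _ "\<kappa> / 1"])
        (use nz False curve[of q] curve[of 1] QWeyl in simp)
    moreover have "some_link (relator n)" using link by (auto simp: some_link_def proper_link_def)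
    moreover have "\<not> some_self_linked (relator n)"
      using q1 by (auto simp: QWeyl link_simps)
    moreover have "\<not> branching_link (relator n)" using nz by (auto simp: QWeyl link_simps)
    moreover have "points_separated (relator n)"
    proof (rule points_separated_x)
      fix a b b' assume "on_curve n a b" "on_curve n a b'"
      then have "(1 - q) * a \<noteq> 0" "(1 - q) * a * b = (1 - q) * a * b'"
        by (auto simp: QWeyl mult.assoc)
      then show "b = b'" by simp
    qed
    moreover have "nonconstant_unit (relator n)"
      by (rule nonconstant_unit_x[OF _ curve[of 1] curve[of 2]]) (auto simp: QWeyl)
    ultimately show ?thesis by (simp add: recognise_def QWeyl False)
  qed
next
  case Jordan
  have "points_separated (relator n)" by (rule points_separated_x) (simp add: Jordan)
  then show ?thesis by (auto simp: recognise_def link_simps Jordan)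
next
  case Jordan1
  obtain i :: 'k where i: "i ^ 2 = - 1" using nth_root_exists[of 2] by auto
  then have ii: "i * i = - 1" and i0: "i \<noteq> 0" by (auto simp: power2_eq_square)
  have "\<not> points_separated (relator n)"
  proof (rule not_points_separated[of n i "- i"])
    show "i \<noteq> - i" using i0 by (metis add.inverse_neutral eq_neg_iff_add_eq_0 mult_2 mult_eq_0_iff zero_neq_numeral)
  qed (simp_all add: Jordan1 ii)
  moreover have "points (relator n) \<noteq> {}" unfolding link_simps Jordan1 using ii by auto
  moreover have link: "proper_link (relator n)" unfolding link_simps Jordan1
    by (rule exI[of _ "2 * i"], rule exI[of _ i], rule exI[of _ 0], rule exI[of _ i])
      (simp add: ii i0)
  moreover have "some_link (relator n)" using link by (auto simp: some_link_def proper_link_def)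
  moreover have "\<not> some_self_linked (relator n)" by (auto simp: Jordan1 link_simps)
  moreover have "\<not> branching_link (relator n)" by (auto simp: Jordan1 link_simps algebra_simps)
  ultimately show ?thesis by (simp add: recognise_def Jordan1)
next
  case Envel
  have "points_separated (relator n)" by (rule points_separated_x) (simp add: Envel)
  moreover have "\<not> nonconstant_unit (relator n)"
    by (rule no_nonconstant_unit[of n 0]) (simp add: Envel)
  moreover have "points (relator n) \<noteq> {}" by (simp add: link_simps Envel)
  moreover have link: "proper_link (relator n)" unfolding link_simps Envel
    by (rule exI[of _ 1], rule exI[of _ 0], rule exI[of _ 0], rule exI[of _ 0]) simp
  moreover have "some_link (relator n)" using link by (auto simp: some_link_def proper_link_def)
  moreover have "\<not> some_self_linked (relator n)" by (auto simp: Envel link_simps)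
  moreover have "\<not> branching_link (relator n)" by (auto simp: Envel link_simps algebra_simps)
  ultimately show ?thesis by (simp add: recognise_def Envel)
next
  case PolyX
  have "\<not> nonconstant_unit (relator n)"
    by (rule no_nonconstant_unit[of n "[:0, 0, - 1:]"]) (simp add: PolyX)
  then show ?thesis by (auto simp: recognise_def link_simps PolyX)
next
  case Rx2
  have "points (relator n) \<noteq> {}" "some_link (relator n)" "all_self_linked (relator n)"
    by (simp_all add: link_simps Rx2)
  moreover have link: "branching_link (relator n)" unfolding link_simps Rx2
    by (rule exI[of _ 0], rule exI[of _ 0], rule exI[of _ 0], rule exI[of _ 0],
        rule exI[of _ 0], rule exI[of _ 1]) simp
  moreover have "proper_link (relator n)"
    using link unfolding proper_link_def branching_link_def by metis
  ultimately show ?thesis by (simp add: recognise_def Rx2)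
next
  case Rx2m1
  have "points (relator n) \<noteq> {}" by (auto simp: link_simps Rx2m1 intro: exI[of _ 1])
  moreover have link: "branching_link (relator n)" unfolding link_simps Rx2m1
    by (rule exI[of _ 1], rule exI[of _ 0], rule exI[of _ "- 1"], rule exI[of _ 0],
        rule exI[of _ "- 1"], rule exI[of _ 1]) simp
  moreover have "proper_link (relator n)" "some_link (relator n)"
    using link unfolding proper_link_def branching_link_def some_link_def by metis+
  moreover have "\<not> some_self_linked (relator n)" "\<not> all_self_linked (relator n)"
    by (auto simp: Rx2m1 link_simps simp flip: mult_2 intro: exI[of _ 1])
  ultimately show ?thesis by (simp add: recognise_def Rx2m1)
next
  case Ryx
  have "points (relator n) \<noteq> {}" by (auto simp: link_simps Ryx intro: exI[of _ 0])
  moreover have link: "branching_link (relator n)" unfolding link_simps Ryx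
    by (rule exI[of _ 0], rule exI[of _ 0], rule exI[of _ 0], rule exI[of _ 0],
        rule exI[of _ 0], rule exI[of _ 1]) simp
  moreover have "proper_link (relator n)" "some_link (relator n)"
    using link unfolding proper_link_def branching_link_def some_link_def by metis+
  moreover have "some_self_linked (relator n)"
    by (auto simp: Ryx link_simps)
  moreover have "\<not> all_self_linked (relator n)"
    unfolding Ryx link_simps not_all by (rule exI[of _ 0], rule exI[of _ 1]) simp
  ultimately show ?thesis by (simp add: recognise_def Ryx)
next
  case Sone
  have "nonconstant_unit (relator n)"
    by (rule nonconstant_unit_x[of n 1 1 2 "1 / 2"]) (auto simp: Sone)
  moreover have "points (relator n) \<noteq> {}" by (auto simp: link_simps Sone intro: exI[of _ 1])
  moreover have "\<not> some_link (relator n)" by (auto simp: link_simps Sone)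
  ultimately show ?thesis by (simp add: recognise_def Sone)
qed

section \<open>The parameters of the quantum planes and quantum Weyl algebras\<close>

lemma poly_eqI_everywhere:
  fixes P Q :: "'k::field_char_0 poly"
  assumes "\<And>t. poly P t = poly Q t"
  shows "P = Q"
  using assms poly_eq_poly_eq_iff by blast

text \<open>
  A polynomial with a polynomial left inverse has degree one, and comparing the linear coefficients in
  \<open>P(ct) = d P(t)\<close> gives \<open>c = d\<close>.
\<close>

lemma invertible_poly_multiplier:
  fixes P U :: "'k::field_char_0 poly"
  assumes inv: "\<And>t. poly U (poly P t) = t" and equiv: "\<And>t. poly P (c * t) = d * poly P t"
  shows "c = d"
proof -
  have "pcompose U P = [:0, 1:]"
    by (rule poly_eqI_everywhere) (simp add: poly_pcompose inv)
  from arg_cong[OF this, of degree] have "degree U * degree P = 1" by (simp add: degree_pcompose)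
  then have "degree P = 1" by simp
  then obtain r s where P: "P = [:r, s:]" and "s \<noteq> 0"
    by (metis degree1_coeffs)
  have "r + s * c = d * (r + s)" "r = d * r"
    using equiv[of 1] equiv[of 0] by (simp_all add: P algebra_simps)
  then have "s * c = s * d" by (simp add: algebra_simps)
  then show ?thesis using \<open>s \<noteq> 0\<close> by simp
qed

text \<open>
  The horizontal axis is mapped to the cross \<open>RS = 0\<close>, hence into one of its axes, and the links
  \<open>(q't, 0)\<close> to \<open>(t, 0)\<close> are mapped to links. A link on the horizontal axis of the target starts at
  \<open>q\<close> times its end; on the vertical axis it ends at \<open>q\<close> times its start.
\<close>

lemma qplane_parameter:
  fixes q q' :: "'k::{alg_closed_field, field_char_0}"
  assumes q: "q \<noteq> 1" "q \<noteq> 0" and q': "q' \<noteq> 1" "q' \<noteq> 0"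
    and iso: "presented (relator (QPlane q)) \<cong>\<^sub>a\<^sub>l\<^sub>g presented (relator (QPlane q'))"
  shows "q = q' \<or> q = inverse q'"
proof -
  let ?f = "relator (QPlane q)" and ?g = "relator (QPlane q')"
  obtain \<phi> \<psi> where inv: "inverse_substitutions ?f ?g \<phi> \<psi>" using iso by (auto simp: presented_iso_iff)
  have g: "pt t 0 \<in> points ?g" for t by (simp add: pt_relator)
  define R S where "R = curve.eval [:0, 1:] 0 (\<phi> ncx)" and "S = curve.eval [:0, 1:] 0 (\<phi> ncy)"
  have "pt t 0 (\<phi> ncx) = poly R t" "pt t 0 (\<phi> ncy) = poly S t" for t
    using pt_on_curve[of "[:0, 1:]" t 0] by (simp_all add: R_def S_def)
  then have image: "pt t 0 \<circ> \<phi> = pt (poly R t) (poly S t)" for t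
    using point_is_pt[OF pull_point[OF inv g[of t]]] by simp
  have "poly (R * S) t = poly 0 t" for t
    using pull_point[OF inv g[of t]] q by (simp add: image pt_relator)
  then have "R * S = 0" by (rule poly_eqI_everywhere)
  then consider "S = 0" | "R = 0" by auto
  then show ?thesis
  proof cases
    case 1
    define U where "U = curve.eval [:0, 1:] 0 (\<psi> ncx)"
    have "poly U (poly R t) = t" for t
    proof -
      have "poly U (poly R t) = pt (poly R t) 0 (\<psi> ncx)"
        using pt_on_curve[of "[:0, 1:]" "poly R t" 0] by (simp add: U_def)
      also have "\<dots> = (pt t 0 \<circ> \<phi>) (\<psi> ncx)" by (simp add: image 1)
      also have "\<dots> = t" using pull_push_point[OF inv g[of t]] by simp
      finally show ?thesis .
    qed
    moreover have "poly R (q' * t) = q * poly R t" for t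
    proof -
      have "linked ?g (pt (q' * t) 0) (pt t 0)" by (simp add: linked_relator)
      from pull_linked[OF inv this] show ?thesis by (simp add: image linked_relator)
    qed
    ultimately have "q' = q" by (rule invertible_poly_multiplier)
    then show ?thesis by simp
  next
    case 2
    define U where "U = curve.eval 0 [:0, 1:] (\<psi> ncx)"
    have "poly U (poly S t) = t" for t
    proof -
      have "poly U (poly S t) = pt 0 (poly S t) (\<psi> ncx)"
        using pt_on_curve[of 0 "poly S t" "[:0, 1:]"] by (simp add: U_def)
      also have "\<dots> = (pt t 0 \<circ> \<phi>) (\<psi> ncx)" by (simp add: image 2)
      also have "\<dots> = t" using pull_push_point[OF inv g[of t]] by simp
      finally show ?thesis .
    qed
    moreover have "poly S (q' * t) = inverse q * poly S t" for t
    proof -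
      have "linked ?g (pt (q' * t) 0) (pt t 0)" by (simp add: linked_relator)
      from pull_linked[OF inv this] have "poly S t = q * poly S (q' * t)"
        by (simp add: image linked_relator)
      then show ?thesis using q by simp
    qed
    ultimately have "q' = inverse q" by (rule invertible_poly_multiplier)
    then show ?thesis by simp
  qed
qed

lemma poly_nonzero_off_origin:
  fixes P :: "'k::alg_closed_field poly"
  assumes "\<And>t. t \<noteq> 0 \<Longrightarrow> poly P t \<noteq> 0"
  obtains c m where "c \<noteq> 0" "P = monom c m"
proof -
  have "P \<noteq> 0" using assms[of 1] by auto
  then obtain Q where P: "P = [:- 0, 1:] ^ order 0 P * Q" and Q: "\<not> [:- 0, 1:] dvd Q"
    using order_decomp by blast
  have "poly Q t \<noteq> 0" for t
  proof (cases "t = 0")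
    case True
    then show ?thesis using Q poly_eq_0_iff_dvd[of Q 0] by simp
  next
    case False
    then show ?thesis using assms[of t] arg_cong[OF P, of "\<lambda>p. poly p t"] by auto
  qed
  then have "degree Q = 0" using alg_closed_imp_poly_has_root by blast
  then obtain c where "Q = [:c:]" by (metis degree_eq_zeroE)
  moreover have "c \<noteq> 0" using \<open>P \<noteq> 0\<close> P \<open>Q = [:c:]\<close> by auto
  moreover have "[:0, 1:] ^ k * [:c:] = monom c k" for k
    by (simp add: monom_altdef)
  ultimately show thesis using that P by (metis minus_zero)
qed

text \<open>
  The hyperbola \<open>ab = \<kappa>\<close> is parametrised by \<open>t \<mapsto> (t, \<kappa>/t)\<close>, and the elements of the algebra become
  Laurent polynomials in \<open>t\<close>.
\<close>

lemma laurent: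
  fixes \<kappa> :: "'k::field" and a :: "'k ncpoly"
  obtains N P where "\<And>t. t \<noteq> 0 \<Longrightarrow> t ^ N * pt t (\<kappa> / t) a = poly P t"
proof -
  have "\<exists>N P. \<forall>t. t \<noteq> 0 \<longrightarrow> t ^ N * pt t (\<kappa> / t) a = poly P t"
  proof (induction a rule: ncpoly_induct)
    case (const c)
    show ?case by (rule exI[of _ 0], rule exI[of _ "[:c:]"]) (simp add: point.eval_simps)
  next
    case x
    show ?case by (rule exI[of _ 0], rule exI[of _ "[:0, 1:]"]) (simp add: point.eval_simps)
  next
    case y
    show ?case by (rule exI[of _ 1], rule exI[of _ "[:\<kappa>:]"]) (simp add: point.eval_simps)
  next
    case (add a b)
    then obtain N P M Q where *: "\<forall>t. t \<noteq> 0 \<longrightarrow> t ^ N * pt t (\<kappa> / t) a = poly P t"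
      "\<forall>t. t \<noteq> 0 \<longrightarrow> t ^ M * pt t (\<kappa> / t) b = poly Q t" by blast
    have "t ^ (N + M) * pt t (\<kappa> / t) (a + b) = poly (monom 1 M * P + monom 1 N * Q) t" if "t \<noteq> 0" for t
    proof -
      have "t ^ (N + M) * pt t (\<kappa> / t) (a + b) =
          t ^ M * (t ^ N * pt t (\<kappa> / t) a) + t ^ N * (t ^ M * pt t (\<kappa> / t) b)"
        by (simp add: point.eval_simps power_add algebra_simps)
      then show ?thesis using * that by (simp add: poly_monom)
    qed
    then show ?case by blast
  next
    case (mult a b)
    then obtain N P M Q where *: "\<forall>t. t \<noteq> 0 \<longrightarrow> t ^ N * pt t (\<kappa> / t) a = poly P t"
      "\<forall>t. t \<noteq> 0 \<longrightarrow> t ^ M * pt t (\<kappa> / t) b = poly Q t" by blast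
    have "t ^ (N + M) * pt t (\<kappa> / t) (a * b) = poly (P * Q) t" if "t \<noteq> 0" for t
    proof -
      have "t ^ (N + M) * pt t (\<kappa> / t) (a * b) =
          (t ^ N * pt t (\<kappa> / t) a) * (t ^ M * pt t (\<kappa> / t) b)"
        by (simp add: point.eval_simps power_add algebra_simps)
      then show ?thesis using * that by simp
    qed
    then show ?case by blast
  qed
  then show thesis using that by blast
qed

text \<open>
  Over an algebraically closed field a Laurent polynomial without zeros is a monomial.
\<close>

lemma laurent_unit:
  fixes \<kappa> :: "'k::alg_closed_field"
  assumes "\<And>t. t \<noteq> 0 \<Longrightarrow> pt t (\<kappa> / t) a \<noteq> 0"
  obtains c n where "c \<noteq> 0" "\<And>t. t \<noteq> 0 \<Longrightarrow> pt t (\<kappa> / t) a = c * t powi n"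
proof -
  obtain N P where P: "\<And>t. t \<noteq> 0 \<Longrightarrow> t ^ N * pt t (\<kappa> / t) a = poly P t"
    using laurent[of \<kappa> a] by blast
  have "poly P t \<noteq> 0" if "t \<noteq> 0" for t using P[OF that] assms[OF that] that by force
  then obtain c m where c: "c \<noteq> 0" "P = monom c m" by (rule poly_nonzero_off_origin)
  have "pt t (\<kappa> / t) a = c * t powi (int m - int N)" if "t \<noteq> 0" for t
    using P[OF that] that by (simp add: c poly_monom power_int_diff field_simps)
  then show thesis using that c(1) by blast
qed

lemma two_powi_eq_one:
  assumes "(2 :: 'k::field_char_0) powi k = 1"
  shows "k = 0"
proof -
  have *: "n = 0" if "(2 :: 'k) ^ n = 1" for n
  proof -
    have "of_nat (2 ^ n) = (of_nat 1 :: 'k)" using that by simp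
    then have "(2 :: nat) ^ n = 1" by (simp only: of_nat_eq_iff)
    then show ?thesis by simp
  qed
  show ?thesis
  proof (cases "k \<ge> 0")
    case True
    then show ?thesis using assms *[of "nat k"] by (simp add: power_int_def)
  next
    case False
    then show ?thesis using assms *[of "nat (- k)"] by (simp add: power_int_def power_one_over)
  qed
qed

lemma qweyl_curve:
  assumes "q \<noteq> 1"
  shows "on_curve (QWeyl q) a b \<longleftrightarrow> a \<noteq> 0 \<and> b = inverse (1 - q) / a"
proof -
  have "1 - q \<noteq> 0" using assms by simp
  moreover have "a \<noteq> 0 \<and> b = inverse (1 - q) / a" if eq: "(1 - q) * (a * b) = 1"
  proof -
    have "a \<noteq> 0" using eq by auto
    then show ?thesis using inverse_unique[OF eq] by simp
  qed
  ultimately show ?thesis by auto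
qed

text \<open>
  In the coordinate \<open>t\<close> the isomorphism and its inverse are \<open>t \<mapsto> c t\<^sup>n\<close> and \<open>t \<mapsto> d t\<^sup>m\<close>; that they are
  inverse to each other, tested at \<open>t = 1\<close> and \<open>t = 2\<close>, forces \<open>n m = 1\<close>. The link from \<open>t = q'\<close> to \<open>t = 1\<close>
  is mapped to a link, which says \<open>q = q'\<^sup>n\<close>.
\<close>

lemma qweyl_parameter:
  fixes q q' :: "'k::{alg_closed_field, field_char_0}"
  assumes q: "q \<noteq> 1" "q \<noteq> 0" and q': "q' \<noteq> 1" "q' \<noteq> 0"
    and iso: "presented (relator (QWeyl q)) \<cong>\<^sub>a\<^sub>l\<^sub>g presented (relator (QWeyl q'))"
  shows "q = q' \<or> q = inverse q'"
proof -
  let ?f = "relator (QWeyl q)" and ?g = "relator (QWeyl q')"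
  obtain \<phi> \<psi> where inv: "inverse_substitutions ?f ?g \<phi> \<psi>" using iso by (auto simp: presented_iso_iff)
  note inv' = inverse_substitutions_sym[OF inv]
  define \<kappa> \<kappa>' where "\<kappa> = inverse (1 - q)" and "\<kappa>' = inverse (1 - q')"
  have f: "pt t (\<kappa> / t) \<in> points ?f" and g: "pt t (\<kappa>' / t) \<in> points ?g" if "t \<noteq> 0" for t
    using that q q' by (simp_all add: pt_relator qweyl_curve \<kappa>_def \<kappa>'_def del: on_curve.simps)
  have image: "pt t (\<kappa>' / t) (\<phi> ncx) \<noteq> 0 \<and>
      pt t (\<kappa>' / t) \<circ> \<phi> = pt (pt t (\<kappa>' / t) (\<phi> ncx)) (\<kappa> / pt t (\<kappa>' / t) (\<phi> ncx))" if t: "t \<noteq> 0" for t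
  proof -
    obtain a b where ab: "pt t (\<kappa>' / t) \<circ> \<phi> = pt a b" "pt a b ?f = 0"
      by (rule points_cases[OF pull_point[OF inv g[OF t]]])
    then have "a = pt t (\<kappa>' / t) (\<phi> ncx)" by (metis comp_apply point.eval_x)
    with ab q show ?thesis
      by (simp add: pt_relator qweyl_curve \<kappa>_def del: on_curve.simps)
  qed
  have image': "pt t (\<kappa> / t) (\<psi> ncx) \<noteq> 0" if t: "t \<noteq> 0" for t
  proof -
    obtain a b where ab: "pt t (\<kappa> / t) \<circ> \<psi> = pt a b" "pt a b ?g = 0"
      by (rule points_cases[OF pull_point[OF inv' f[OF t]]])
    then have "a = pt t (\<kappa> / t) (\<psi> ncx)" by (metis comp_apply point.eval_x)
    with ab q' show ?thesis
      by (simp add: pt_relator qweyl_curve del: on_curve.simps)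
  qed
  obtain c n where c: "c \<noteq> 0" and x: "\<And>t. t \<noteq> 0 \<Longrightarrow> pt t (\<kappa>' / t) (\<phi> ncx) = c * t powi n"
    using laurent_unit[of \<kappa>' "\<phi> ncx"] image by metis
  obtain c' n' where c': "c' \<noteq> 0" and x': "\<And>t. t \<noteq> 0 \<Longrightarrow> pt t (\<kappa> / t) (\<psi> ncx) = c' * t powi n'"
    using laurent_unit[of \<kappa> "\<psi> ncx"] image' by metis
  have round: "c' * c powi n' * t powi (n * n') = t" if t: "t \<noteq> 0" for t
  proof -
    have nz: "c * t powi n \<noteq> 0" using c t by simp
    have "t = (pt t (\<kappa>' / t) \<circ> \<phi>) (\<psi> ncx)" using pull_push_point[OF inv g[OF t]] by simp
    also have "\<dots> = pt (c * t powi n) (\<kappa> / (c * t powi n)) (\<psi> ncx)" using image[OF t] x[OF t] by simp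
    also have "\<dots> = c' * (c * t powi n) powi n'" by (rule x'[OF nz])
    finally show ?thesis by (simp add: power_int_mult_distrib power_int_mult mult.assoc)
  qed
  have "c' * c powi n' = 1" using round[of 1] by simp
  then have "(2 :: 'k) powi (n * n') = 2" using round[of 2] by simp
  then have "(2 :: 'k) powi (n * n' - 1) = 1" by (simp add: power_int_diff)
  then have "n * n' = 1" using two_powi_eq_one by fastforce
  then have n: "n = 1 \<or> n = - 1" by (metis zmult_eq_1_iff)
  have "linked ?g (pt q' (\<kappa>' / q')) (pt 1 (\<kappa>' / 1))"
    using q' by (auto simp: linked_relator qweyl_curve \<kappa>'_def simp del: on_curve.simps)
  from pull_linked[OF inv this] have "c * q' powi n = q * (c * 1 powi n)"
    using image[of q'] image[of 1] q' x[of q'] x[of 1] by (simp add: linked_relator)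
  then have "q = q' powi n" using c by simp
  then show ?thesis using n by auto
qed

lemma qplane_inverse:
  assumes "q \<noteq> 0"
  shows "presented (relator (QPlane q)) \<cong>\<^sub>a\<^sub>l\<^sub>g presented (relator (QPlane (inverse q)))"
proof (rule alg_iso_trans)
  show "presented (relator (QPlane q)) \<cong>\<^sub>a\<^sub>l\<^sub>g presented (quad 0 (- q) 1 0 0 0 0)"
    unfolding relator_quad by (rule iso_swap)
  show "presented (quad 0 (- q) 1 0 0 0 0) \<cong>\<^sub>a\<^sub>l\<^sub>g presented (relator (QPlane (inverse q)))"
    using iso_scale[of "- inverse q" 0 "- q" 1 0 0 0 0] assms by (simp add: relator_quad)
qed

lemma qweyl_inverse:
  assumes "q \<noteq> 0"
  shows "presented (relator (QWeyl q)) \<cong>\<^sub>a\<^sub>l\<^sub>g presented (relator (QWeyl (inverse q)))"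
proof (rule alg_iso_trans)
  show "presented (relator (QWeyl q)) \<cong>\<^sub>a\<^sub>l\<^sub>g presented (quad 0 (- q) 1 0 0 0 (- 1))"
    unfolding relator_quad by (rule iso_swap)
  show "presented (quad 0 (- q) 1 0 0 0 (- 1)) \<cong>\<^sub>a\<^sub>l\<^sub>g presented (relator (QWeyl (inverse q)))"
    using iso_affine[of "- inverse q" 0 "- q" 1 0 0 0 "- 1" 0 0] assms by (simp add: relator_quad)
qed

lemma kind_eq:
  assumes "kind m = kind n"
  shows "m = n \<or> (\<exists>q q'. m = QPlane q \<and> n = QPlane q' \<and> q \<noteq> 1 \<and> q' \<noteq> 1) \<or>
    (\<exists>q q'. m = QWeyl q \<and> n = QWeyl q' \<and> q \<noteq> 1 \<and> q' \<noteq> 1)"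
  using assms by (cases m; cases n) (auto split: if_splits)

lemma normal_form_iso_iff:
  fixes m n :: "'k::{alg_closed_field, field_char_0} normal_form"
  assumes "admissible m" "admissible n"
  shows "presented (relator m) \<cong>\<^sub>a\<^sub>l\<^sub>g presented (relator n) \<longleftrightarrow>
    m = n \<or> (\<exists>q. m = QPlane q \<and> n = QPlane (inverse q)) \<or> (\<exists>q. m = QWeyl q \<and> n = QWeyl (inverse q))"
    (is "?iso \<longleftrightarrow> ?R")
proof
  assume iso: ?iso
  then have "kind m = kind n" using recognise_iso recognise_relator assms by metis
  then consider "m = n" | q q' where "m = QPlane q" "n = QPlane q'" "q \<noteq> 1" "q' \<noteq> 1"
    | q q' where "m = QWeyl q" "n = QWeyl q'" "q \<noteq> 1" "q' \<noteq> 1" using kind_eq by blast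
  then show ?R
  proof cases
    case 2
    then show ?thesis using qplane_parameter[of q q'] iso assms by auto
  next
    case 3
    then show ?thesis using qweyl_parameter[of q q'] iso assms by auto
  qed simp
next
  assume ?R
  then show ?iso using presented_iso_refl qplane_inverse qweyl_inverse assms by auto
qed

theorem theorem1p1:
  shows "(\<forall>(A :: ('k::{alg_closed_field, field_char_0}, 'a) module) (f :: 'k ncpoly).
            is_algebra A \<longrightarrow> ncdegree f = 2 \<longrightarrow> A \<cong>\<^sub>a\<^sub>l\<^sub>g presented f \<longrightarrow>
            (\<exists>n. admissible n \<and> A \<cong>\<^sub>a\<^sub>l\<^sub>g presented (relator n)))
       \<and> (\<forall>m n :: 'k normal_form. admissible m \<longrightarrow> admissible n \<longrightarrow>
            (presented (relator m) \<cong>\<^sub>a\<^sub>l\<^sub>g presented (relator n) \<longleftrightarrow>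
              m = n
              \<or> (\<exists>q. m = QPlane q \<and> n = QPlane (inverse q))
              \<or> (\<exists>q. m = QWeyl q \<and> n = QWeyl (inverse q))))"
proof (intro conjI allI impI)
  fix A :: "('k, 'a) module" and f :: "'k ncpoly"
  assume "ncdegree f = 2" and iso: "A \<cong>\<^sub>a\<^sub>l\<^sub>g presented f"
  then have "has_normal_form f" by (metis degree_two_quad normal_form_quad)
  then show "\<exists>n. admissible n \<and> A \<cong>\<^sub>a\<^sub>l\<^sub>g presented (relator n)"
    using alg_iso_trans[OF iso] by (auto simp: has_normal_form_def)
qed (rule normal_form_iso_iff)

end
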